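(* Let $n\ge 2$ and $d\ge 1$ be integers, and let $F\in\mathbb{Z}[X_1,\ldots,X_n]$ be a decomposable form of degree $d$ in $n$ variables; if $n=2$ assume $F$ is not a nonzero constant multiple of a power of a positive definite quadratic form in two variables. Then $V(F)$ is finite if and only if $a(F)$ is defined and $a(F)<d/n$.
   Context: A decomposable form of degree $d$ in $n$ variables is a homogeneous polynomial of degree $d$ that factors as $F(\mathbf{X})=\prod_{i=1}^d L_i(\mathbf{X})$, where each $L_i(\mathbf X)\in\mathbb{C}[X_1,\ldots,X_n]$ is a nonzero homogeneous linear form; $\mathbf{L}_i\in\mathbb{C}^n$ denotes its coefficient vector. $V(F)$ is the $n$-dimensional volume of $\{\mathbf{x}\in\mathbb{R}^n:|F(\mathbf{x})|\le 1\}$. Vectors $\mathbf L_i$ with different indices are counted separately. $I(F)$ is the set of ordered $n$-tuples $(\mathbf{L}_{i_1},\ldots,\mathbf{L}_{i_n})$ of (over $\mathbb{C}$) linearly independent coefficient vectors. $J(F)\subseteq I(F)$ is the subset of $n$-tuples such that for every $j<n$, either $\mathbf{L}_{i_{j+1}}$ is proportional to the complex conjugate $\overline{\mathbf{L}_{i_j}}$ or $\overline{\mathbf{L}_{i_j}}$ lies in the (complex) span of $\mathbf{L}_{i_1},\ldots,\mathbf{L}_{i_j}$. If $J(F)\ne\emptyset$, $$a(F)=\max\frac{\#\{i:\ \mathbf{L}_i\in\operatorname{span}(\mathbf{L}_{i_1},\ldots,\mathbf{L}_{i_j})\}}{j},$$ the maximum over all $n$-tuples in $J(F)$ and all $j=1,\ldots,n-1$;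 if $J(F)=\emptyset$, $a(F)$ is undefined. *)

theory Defs
  imports "HOL-Analysis.Analysis" "HOL-Library.Poly_Mapping"
begin

text \<open>
  Polynomials in the variables \<open>X\<^sub>i\<close>, \<open>i :: 'n\<close>: finitely supported maps from exponent
  vectors to coefficients. Throughout, the number of variables is \<open>CARD('n)\<close>.
\<close>

type_synonym ('n, 'a) mpoly = "('n \<Rightarrow>\<^sub>0 nat) \<Rightarrow>\<^sub>0 'a"

definition mconst :: "'a::zero \<Rightarrow> ('n, 'a) mpoly" where
  "mconst c = Poly_Mapping.single 0 c"

definition linear_form :: "'a::comm_semiring_1 ^ 'n::finite \<Rightarrow> ('n, 'a) mpoly" where
  "linear_form v = (\<Sum>i\<in>UNIV. Poly_Mapping.single (Poly_Mapping.single i 1) (v $ i))"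

definition mpoly_eval :: "('n::finite, 'a::comm_semiring_1) mpoly \<Rightarrow> 'a ^ 'n \<Rightarrow> 'a" where
  "mpoly_eval p x = (\<Sum>m\<in>Poly_Mapping.keys p.
     Poly_Mapping.lookup p m * (\<Prod>i\<in>UNIV. (x $ i) ^ Poly_Mapping.lookup m i))"

definition homogeneous :: "nat \<Rightarrow> ('n::finite, 'a::zero) mpoly \<Rightarrow> bool" where
  "homogeneous k p \<longleftrightarrow> (\<forall>m\<in>Poly_Mapping.keys p. (\<Sum>i\<in>UNIV. Poly_Mapping.lookup m i) = k)"

definition positive_definite_quadratic_form :: "('n::finite, real) mpoly \<Rightarrow> bool" where
  "positive_definite_quadratic_form Q \<longleftrightarrow>
     homogeneous 2 Q \<and> (\<forall>x. x \<noteq> 0 \<longrightarrow> mpoly_eval Q x > 0)"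

text \<open>
  \<open>linear_factorization F d L\<close>: over the complex numbers, \<open>F\<close> is the product of the nonzero
  linear forms with coefficient vectors \<open>L 1, \<dots>, L d\<close>. This makes \<open>F\<close> homogeneous of degree
  \<open>d\<close>, so \<open>F\<close> is a decomposable form of degree \<open>d\<close> iff such an \<open>L\<close> exists.
\<close>

definition linear_factorization ::
    "('n::finite, int) mpoly \<Rightarrow> nat \<Rightarrow> (nat \<Rightarrow> complex ^ 'n) \<Rightarrow> bool" where
  "linear_factorization F d L \<longleftrightarrow>
     (\<forall>i\<in>{1..d}. L i \<noteq> 0) \<and>
     Poly_Mapping.map of_int F = (\<Prod>i=1..d. linear_form (L i))"

definition form_volume :: "('n::finite, int) mpoly \<Rightarrow> ennreal" where
  "form_volume F = emeasure lborel
     {x :: real ^ 'n. \<bar>mpoly_eval (Poly_Mapping.map real_of_int F) x\<bar> \<le> 1}"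

definition cnj_vec :: "complex ^ 'n \<Rightarrow> complex ^ 'n" where
  "cnj_vec v = (\<chi> i. cnj (v $ i))"

text \<open>
  Ordered \<open>n\<close>-tuples of coefficient vectors are represented by the lists of their indices, so
  that vectors with different indices are distinguished even if they coincide. List positions
  start at 0, hence \<open>is ! (j - 1)\<close> is the \<open>j\<close>-th index. The complex linear notions are those of
  the locale interpretation \<open>vec\<close>; the unqualified \<open>span\<close> and \<open>independent\<close> would be real.
\<close>

definition I_tuples :: "nat \<Rightarrow> (nat \<Rightarrow> complex ^ 'n::finite) \<Rightarrow> nat list set" where
  "I_tuples d L = {is. length is = CARD('n) \<and> set is \<subseteq> {1..d} \<and>
     distinct (map L is) \<and> vec.independent (set (map L is))}"

definition span_first :: "(nat \<Rightarrow> complex ^ 'n::finite) \<Rightarrow> nat list \<Rightarrow> nat \<Rightarrow> (complex ^ 'n) set"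
  where "span_first L is j = vec.span (set (map L (take j is)))"

definition J_tuples :: "nat \<Rightarrow> (nat \<Rightarrow> complex ^ 'n::finite) \<Rightarrow> nat list set" where
  "J_tuples d L = {is \<in> I_tuples d L. \<forall>j\<in>{1..<CARD('n)}.
     (\<exists>c. L (is ! j) = c *s cnj_vec (L (is ! (j - 1)))) \<or>
     cnj_vec (L (is ! (j - 1))) \<in> span_first L is j}"

text \<open>The invariant \<open>a(F)\<close>; the value \<open>None\<close> means that it is undefined.\<close>

definition a_invariant :: "nat \<Rightarrow> (nat \<Rightarrow> complex ^ 'n::finite) \<Rightarrow> real option" where
  "a_invariant d L =
     (if J_tuples d L = {} then None
      else Some (Max {real (card {i \<in> {1..d}. L i \<in> span_first L is j}) / real j | is j.
                        is \<in> J_tuples d L \<and> j \<in> {1..<CARD('n)}}))"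

end

theory Submission
  imports Defs
begin

text \<open>
  For a real subspace \<open>U\<close> let \<open>m(U)\<close> be the number of \<open>i\<close> with \<open>Re L\<^sub>i, Im L\<^sub>i \<in> U\<close>. The volume is
  finite iff \<open>n m(U) < d dim U\<close> for all \<open>U\<close> with \<open>0 < dim U < n\<close>.

  If this fails for \<open>U\<close>, then in coordinates adapted to \<open>U\<close> the region contains infinitely many
  disjoint boxes with sides of length about \<open>2\<^sup>t\<close> across and \<open>2\<close> to the power \<open>-t(d-m)/m\<close> along the
  forms in \<open>U\<close>, whose volumes are bounded below. If it holds, choose for every point \<open>x\<close> a basis \<open>B\<close>
  among the vectors \<open>Re L\<^sub>i, Im L\<^sub>i\<close> that is minimal for the weight \<open>|b \<bullet> x|\<close>. Each such vector lies
  in the span of the basis vectors that are not larger at \<open>x\<close>, so the counting condition turns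
  \<open>|F(x)| \<le> 1\<close> into \<open>\<Prod>\<^sub>b h(b \<bullet> x) \<ge> 1\<close> for a fixed integrable \<open>h\<close>, and Markov's inequality bounds the
  volume for each of the finitely many \<open>B\<close>.

  Real subspaces correspond to complex subspaces stable under conjugation. At a stage \<open>j\<close> of a tuple
  in \<open>J(F)\<close> the span is stable, or its two neighbours are. In the latter case the conjugate span
  contains equally many \<open>L\<^sub>i\<close>, since \<open>F\<close> is real, and inclusion-exclusion bounds the count at stage
  \<open>j\<close> by the mean of the counts at its neighbours. Equality in the resulting bound is only
  possible for \<open>n = 2\<close> and the excluded forms.
\<close>

section \<open>Values of linear forms; real and imaginary parts of vectors\<close>

text \<open>The pairing is bilinear, not hermitian: it must be complex linear in \<open>v\<close>
  too, so that the \<open>v\<close> vanishing at a given point form a complex subspace.\<close>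

definition form_eval :: "complex ^ 'n::finite \<Rightarrow> complex ^ 'n \<Rightarrow> complex" where
  "form_eval v z = (\<Sum>i\<in>UNIV. v $ i * z $ i)"

definition Re_vec :: "complex ^ 'n \<Rightarrow> real ^ 'n" where
  "Re_vec v = (\<chi> i. Re (v $ i))"

definition Im_vec :: "complex ^ 'n \<Rightarrow> real ^ 'n" where
  "Im_vec v = (\<chi> i. Im (v $ i))"

definition complex_vec :: "real ^ 'n \<Rightarrow> complex ^ 'n" where
  "complex_vec v = (\<chi> i. of_real (v $ i))"

section \<open>Evaluation of polynomials\<close>

lemma mpoly_eval_superset:
  assumes "finite A" "Poly_Mapping.keys p \<subseteq> A"
  shows "mpoly_eval p x =
    (\<Sum>m\<in>A. Poly_Mapping.lookup p m * (\<Prod>i\<in>UNIV. (x $ i) ^ Poly_Mapping.lookup m i))"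
  unfolding mpoly_eval_def using assms
  by (intro sum.mono_neutral_left) (auto simp: in_keys_iff)

lemma mpoly_eval_zero [simp]: "mpoly_eval 0 x = 0"
  by (simp add: mpoly_eval_def)

lemma mpoly_eval_add: "mpoly_eval (p + q) x = mpoly_eval p x + mpoly_eval q x"
proof -
  let ?A = "Poly_Mapping.keys p \<union> Poly_Mapping.keys q"
  show ?thesis
    using mpoly_eval_superset[of ?A p x] mpoly_eval_superset[of ?A q x]
      mpoly_eval_superset[of ?A "p + q" x] Poly_Mapping.keys_add[of p q]
    by (simp add: lookup_add distrib_right sum.distrib)
qed

lemma mpoly_eval_sum: "mpoly_eval (\<Sum>k\<in>A. f k) x = (\<Sum>k\<in>A. mpoly_eval (f k) x)"
  by (induction A rule: infinite_finite_induct) (auto simp: mpoly_eval_add)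

lemma mpoly_eval_single:
  "mpoly_eval (Poly_Mapping.single m c) x = c * (\<Prod>i\<in>UNIV. (x $ i) ^ Poly_Mapping.lookup m i)"
  by (cases "c = 0") (auto simp: mpoly_eval_def)

lemma poly_mapping_sum_singles:
  "p = (\<Sum>m\<in>Poly_Mapping.keys p. Poly_Mapping.single m (Poly_Mapping.lookup p m))"
proof (rule poly_mapping_eqI)
  fix k
  show "Poly_Mapping.lookup p k = Poly_Mapping.lookup
      (\<Sum>m\<in>Poly_Mapping.keys p. Poly_Mapping.single m (Poly_Mapping.lookup p m)) k"
    by (auto simp: lookup_sum lookup_single in_keys_iff when_def)
qed

lemma mpoly_eval_mult: "mpoly_eval (p * q) x = mpoly_eval p x * mpoly_eval q x"
proof -
  have single: "mpoly_eval (Poly_Mapping.single m a * Poly_Mapping.single k b) x =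
      mpoly_eval (Poly_Mapping.single m a) x * mpoly_eval (Poly_Mapping.single k b) x" for m k a b
    by (simp add: mult_single mpoly_eval_single lookup_add power_add prod.distrib mult_ac)
  have "mpoly_eval (p * q) x =
      mpoly_eval ((\<Sum>m\<in>Poly_Mapping.keys p. Poly_Mapping.single m (Poly_Mapping.lookup p m)) *
        (\<Sum>m\<in>Poly_Mapping.keys q. Poly_Mapping.single m (Poly_Mapping.lookup q m))) x"
    using poly_mapping_sum_singles[of p] poly_mapping_sum_singles[of q] by simp
  also have "\<dots> = (\<Sum>m\<in>Poly_Mapping.keys p. mpoly_eval (Poly_Mapping.single m (Poly_Mapping.lookup p m)) x) *
        (\<Sum>m\<in>Poly_Mapping.keys q. mpoly_eval (Poly_Mapping.single m (Poly_Mapping.lookup q m)) x)"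
    by (simp add: sum_product mpoly_eval_sum single)
  also have "\<dots> = mpoly_eval p x * mpoly_eval q x"
    by (simp flip: mpoly_eval_sum poly_mapping_sum_singles)
  finally show ?thesis .
qed

lemma mpoly_eval_one [simp]: "mpoly_eval 1 x = 1"
  using mpoly_eval_single[of 0 1 x] by simp

lemma mpoly_eval_prod: "mpoly_eval (\<Prod>k\<in>A. f k) x = (\<Prod>k\<in>A. mpoly_eval (f k) x)"
  by (induction A rule: infinite_finite_induct) (auto simp: mpoly_eval_mult)

lemma prod_power_lookup_single:
  fixes x :: "'a::comm_semiring_1 ^ 'n::finite"
  shows "(\<Prod>j\<in>UNIV. (x $ j) ^ Poly_Mapping.lookup (Poly_Mapping.single i 1) j) = x $ i"
  by (simp add: lookup_single when_def if_distrib[of "\<lambda>k. _ ^ k"] cong: if_cong)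

lemma mpoly_eval_linear_form: "mpoly_eval (linear_form v) x = (\<Sum>i\<in>UNIV. v $ i * x $ i)"
  unfolding linear_form_def mpoly_eval_sum mpoly_eval_single prod_power_lookup_single ..

lemma lookup_map: "f 0 = 0 \<Longrightarrow> Poly_Mapping.lookup (Poly_Mapping.map f p) m = f (Poly_Mapping.lookup p m)"
  by (simp add: Poly_Mapping.map.rep_eq when_def)

text \<open>Summing over the keys of \<open>p\<close> itself makes evaluations of \<open>F\<close>
  under different coefficient maps comparable term by term; coefficients sent to zero contribute
  nothing.\<close>

lemma mpoly_eval_map:
  assumes "f 0 = 0"
  shows "mpoly_eval (Poly_Mapping.map f p) x = (\<Sum>m\<in>Poly_Mapping.keys p.
     f (Poly_Mapping.lookup p m) * (\<Prod>i\<in>UNIV. (x $ i) ^ Poly_Mapping.lookup m i))"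
proof -
  have lookup: "Poly_Mapping.lookup (Poly_Mapping.map f p) m = f (Poly_Mapping.lookup p m)" for m
    using assms by (rule lookup_map)
  then have "Poly_Mapping.keys (Poly_Mapping.map f p) \<subseteq> Poly_Mapping.keys p"
    by (auto simp: in_keys_iff assms)
  then show ?thesis by (subst mpoly_eval_superset) (auto simp: lookup)
qed

text \<open>Both sides are additive in \<open>p\<close> and in \<open>q\<close>, so it is enough to
  compare them on monomials.\<close>

lemma map_hom_mult:
  fixes f :: "'a::comm_semiring_1 \<Rightarrow> 'b::comm_semiring_1" and p q :: "('n, 'a) mpoly"
  assumes [simp]: "f 0 = 0" "\<And>a b. f (a + b) = f a + f b" "\<And>a b. f (a * b) = f a * f b"
  shows "Poly_Mapping.map f (p * q) = Poly_Mapping.map f p * Poly_Mapping.map f q"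
proof -
  have add: "Poly_Mapping.map f (r + s) = Poly_Mapping.map f r + Poly_Mapping.map f s"
    for r s :: "('n, 'a) mpoly"
    by (rule poly_mapping_eqI) (simp add: lookup_map lookup_add)
  have sum: "Poly_Mapping.map f (\<Sum>k\<in>A. g k) = (\<Sum>k\<in>A. Poly_Mapping.map f (g k))"
    for g :: "'c \<Rightarrow> ('n, 'a) mpoly" and A
    by (induction A rule: infinite_finite_induct) (auto simp: add map_eq_zero_iff)
  have single: "Poly_Mapping.map f (Poly_Mapping.single m c) = Poly_Mapping.single m (f c)"
    for m :: "'n \<Rightarrow>\<^sub>0 nat" and c by (rule poly_mapping_eqI) (simp add: lookup_map lookup_single when_def)
  let ?P = "\<Sum>m\<in>Poly_Mapping.keys p. Poly_Mapping.single m (Poly_Mapping.lookup p m)"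
  let ?Q = "\<Sum>m\<in>Poly_Mapping.keys q. Poly_Mapping.single m (Poly_Mapping.lookup q m)"
  have "Poly_Mapping.map f (?P * ?Q) = Poly_Mapping.map f ?P * Poly_Mapping.map f ?Q"
    by (simp add: sum_product sum single mult_single)
  then show ?thesis by (simp flip: poly_mapping_sum_singles)
qed

section \<open>Evaluation of a product of linear forms at real and conjugate points\<close>

lemma form_eval_add_right: "form_eval v (x + y) = form_eval v x + form_eval v y"
  by (simp add: form_eval_def distrib_left sum.distrib)

lemma form_eval_scale_right: "form_eval v (c *s x) = c * form_eval v x"
  by (simp add: form_eval_def sum_distrib_left mult_ac)

lemma form_eval_add_left: "form_eval (u + v) x = form_eval u x + form_eval v x"
  by (simp add: form_eval_def distrib_right sum.distrib)

lemma form_eval_scale_left: "form_eval (c *s v) x = c * form_eval v x"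
  by (simp add: form_eval_def sum_distrib_left mult_ac)

lemma form_eval_cnj: "form_eval (cnj_vec v) (cnj_vec z) = cnj (form_eval v z)"
  by (simp add: form_eval_def cnj_vec_def)

lemma cnj_vec_cnj_vec [simp]: "cnj_vec (cnj_vec v) = v"
  by (simp add: cnj_vec_def vec_eq_iff)

lemma Re_form_eval: "Re (form_eval v (complex_vec x)) = Re_vec v \<bullet> x"
  and Im_form_eval: "Im (form_eval v (complex_vec x)) = Im_vec v \<bullet> x"
  by (simp_all add: form_eval_def complex_vec_def Re_vec_def Im_vec_def inner_vec_def)

lemma linear_factorization_eval:
  assumes "linear_factorization F d L"
  shows "mpoly_eval (Poly_Mapping.map of_int F) z = (\<Prod>i=1..d. form_eval (L i) z)"
  using assms
  by (simp add: linear_factorization_def mpoly_eval_prod mpoly_eval_linear_form form_eval_def)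

lemma linear_factorization_eval_real:
  assumes "linear_factorization F d L"
  shows "\<bar>mpoly_eval (Poly_Mapping.map real_of_int F) x\<bar>
    = (\<Prod>i=1..d. norm (form_eval (L i) (complex_vec x)))"
proof -
  have "complex_of_real (mpoly_eval (Poly_Mapping.map real_of_int F) x)
      = mpoly_eval (Poly_Mapping.map of_int F) (complex_vec x)"
    by (simp add: mpoly_eval_map complex_vec_def)
  then have "\<bar>mpoly_eval (Poly_Mapping.map real_of_int F) x\<bar>
      = norm (mpoly_eval (Poly_Mapping.map of_int F) (complex_vec x))"
    by (metis norm_of_real)
  then show ?thesis by (simp add: linear_factorization_eval[OF assms] prod_norm)
qed

text \<open>The coefficients of \<open>F\<close> are integers, hence fixed by conjugation. This is
  how the reality of \<open>F\<close> enters the study of the factors \<open>L i\<close>.\<close>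

lemma linear_factorization_eval_cnj:
  assumes "linear_factorization F d L"
  shows "(\<Prod>i=1..d. form_eval (L i) (cnj_vec z)) = cnj (\<Prod>i=1..d. form_eval (L i) z)"
  unfolding linear_factorization_eval[OF assms, symmetric]
  by (simp add: mpoly_eval_map cnj_vec_def)

section \<open>Finite volume\<close>

text \<open>A basis of least total weight works, as in the greedy algorithm for matroids: if
  \<open>r\<close> were outside the span of the basis vectors that are not heavier, it could replace
  a heavier one and lower the sum.\<close>

lemma exists_min_weight_basis:
  fixes R :: "'a::euclidean_space set" and v :: "'a \<Rightarrow> real"
  assumes fin: "finite R" and span: "span R = UNIV"
  obtains B where "B \<subseteq> R" "independent B" "card B = DIM('a)"
    "\<And>r. r \<in> R \<Longrightarrow> r \<in> span {b \<in> B. v b \<le> v r}"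
proof -
  define \<B> where "\<B> = {B. B \<subseteq> R \<and> independent B \<and> span B = UNIV}"
  have "finite \<B>"
    by (rule finite_subset[of _ "Pow R"]) (auto simp: \<B>_def fin)
  moreover have "\<B> \<noteq> {}"
  proof -
    obtain B where B: "B \<subseteq> R" "independent B" "R \<subseteq> span B"
      using maximal_independent_subset by blast
    then have "span R \<subseteq> span B" by (simp add: span_minimal)
    then show ?thesis using B span by (auto simp: \<B>_def)
  qed
  ultimately obtain B where B: "B \<in> \<B>" and min: "\<And>B'. B' \<in> \<B> \<Longrightarrow> sum v B \<le> sum v B'"
    using arg_min_if_finite[of \<B> "sum v"] by (meson not_le)
  have B': "B \<subseteq> R" "independent B" "span B = UNIV" "finite B"
    using B fin finite_subset by (auto simp: \<B>_def)
  then have cardB: "card B = DIM('a)"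
    using dim_eq_card_independent[of B] dim_span[of B] by simp
  have "r \<in> span {b \<in> B. v b \<le> v r}" if r: "r \<in> R" for r
  proof (rule ccontr)
    define C where "C = {b \<in> B. v b \<le> v r}"
    assume "r \<notin> span {b \<in> B. v b \<le> v r}"
    then have notC: "r \<notin> span C" by (simp add: C_def)
    then have "r \<notin> B" by (auto simp: C_def intro: span_base)
    \<comment> \<open>In an inclusion-minimal \<open>D\<close> between \<open>C\<close> and
      \<open>B\<close> that still spans \<open>r\<close>, each \<open>b\<close> outside
      \<open>C\<close> is indispensable. Exchange then puts \<open>b\<close> in the span of
      \<open>r\<close> and the other vectors, and such a \<open>b\<close> is heavier than
      \<open>r\<close>.\<close>
    define \<D> where "\<D> = {D. C \<subseteq> D \<and> D \<subseteq> B \<and> r \<in> span D}"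
    have "finite \<D>" by (rule finite_subset[of _ "Pow B"]) (auto simp: \<D>_def B')
    moreover have "B \<in> \<D>" using B' by (auto simp: \<D>_def C_def)
    ultimately obtain D where D: "D \<in> \<D>" and Dmin: "\<And>D'. D' \<in> \<D> \<Longrightarrow> D' \<subseteq> D \<Longrightarrow> D' = D"
      by (metis finite_has_minimal2)
    have "D \<noteq> C" using D notC by (auto simp: \<D>_def)
    then obtain b where b: "b \<in> D" "b \<notin> C" using D by (auto simp: \<D>_def)
    have "D - {b} \<notin> \<D>" using Dmin[of "D - {b}"] b by blast
    then have "r \<notin> span (D - {b})" using D b by (auto simp: \<D>_def)
    moreover have "r \<in> span (insert b (D - {b}))" using D b by (auto simp: \<D>_def insert_absorb)
    ultimately have "b \<in> span (insert r (D - {b}))" using in_span_insert by blast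
    moreover have "D \<subseteq> B" using D by (auto simp: \<D>_def)
    ultimately have bspan: "b \<in> span (insert r (B - {b}))"
      by (meson Diff_mono insert_mono span_mono subset_eq)
    have bB: "b \<in> B" "v r < v b" using b \<open>D \<subseteq> B\<close> by (auto simp: C_def)
    define B2 where "B2 = insert r (B - {b})"
    have "B \<subseteq> span B2"
      using bspan by (auto simp: B2_def intro: span_base)
    then have "span B \<subseteq> span B2" by (simp add: span_minimal)
    then have sp: "span B2 = UNIV" using B' by auto
    have "card B2 = DIM('a)"
      using bB \<open>r \<notin> B\<close> B' cardB by (simp add: B2_def card_insert_if card_Diff_singleton)
    then have "independent B2"
      using card_le_dim_spanning[of B2 UNIV] sp B' by (simp add: B2_def)
    then have "B2 \<in> \<B>" using sp r B' by (auto simp: \<B>_def B2_def)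
    then have "sum v B \<le> sum v B2" by (rule min)
    also have "sum v B2 = v r + (sum v B - v b)"
      using \<open>r \<notin> B\<close> bB B' by (simp add: B2_def sum_diff1)
    finally show False using bB by simp
  qed
  with B' cardB that show ?thesis by blast
qed

text \<open>Layer cake: \<open>Z - y\<close> is the measure of the set of levels \<open>t\<close> with \<open>y \<le> t < Z\<close>.\<close>
lemma sum_gaps_le:
  fixes y :: "'a \<Rightarrow> real" and z :: "'b \<Rightarrow> real"
  assumes fin: "finite I" "finite B"
    and z: "\<And>b. b \<in> B \<Longrightarrow> z b \<le> Z"
    and le: "\<And>t. t < Z \<Longrightarrow> real (card {i \<in> I. y i \<le> t}) \<le> q * real (card {b \<in> B. z b \<le> t})"
  shows "(\<Sum>i\<in>I. Z - y i) \<le> q * (\<Sum>b\<in>B. Z - z b)"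
proof -
  define A where "A = Min (insert Z (y ` I \<union> z ` B))"
  have A: "A \<le> Z" "\<And>i. i \<in> I \<Longrightarrow> A \<le> y i" "\<And>b. b \<in> B \<Longrightarrow> A \<le> z b"
    using fin by (auto simp: A_def)
  \<comment> \<open>\<open>g w\<close> is the indicator of the levels from \<open>w\<close> up to,
    but excluding, \<open>Z\<close>: the hypothesis \<open>le\<close> is available only below
    \<open>Z\<close>. An index with \<open>y i > Z\<close> then contributes 0 instead of the
    negative \<open>Z - y i\<close>, which only enlarges the left side.\<close>
  define g where "g w t = (if w \<le> t \<and> t < Z then 1 else 0 :: real)" for w t
  have g: "(g w has_integral max 0 (Z - w)) {A..Z}" if "A \<le> w" for w
  proof -
    have "((\<lambda>t. 1) has_integral max 0 (Z - w)) {w..Z}"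
      using has_integral_const_real[of "1::real" w Z] by (simp add: max_def)
    then have "((\<lambda>t. if t \<in> {w..Z} then 1 else 0) has_integral max 0 (Z - w)) {A..Z}"
      using that by (subst has_integral_restrict) auto
    then show ?thesis
      by (rule has_integral_spike_finite[of "{Z}", rotated 2]) (auto simp: g_def)
  qed
  have "((\<lambda>t. \<Sum>i\<in>I. g (y i) t) has_integral (\<Sum>i\<in>I. max 0 (Z - y i))) {A..Z}"
    using fin A by (intro has_integral_sum g) auto
  moreover have "((\<lambda>t. q * (\<Sum>b\<in>B. g (z b) t)) has_integral q * (\<Sum>b\<in>B. max 0 (Z - z b))) {A..Z}"
    using fin A by (intro has_integral_mult_right has_integral_sum g) auto
  moreover have "(\<Sum>i\<in>I. g (y i) t) \<le> q * (\<Sum>b\<in>B. g (z b) t)" for t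
  proof (cases "t < Z")
    case True
    have "(\<Sum>i\<in>I. g (y i) t) = card {i \<in> I. y i \<le> t}" "(\<Sum>b\<in>B. g (z b) t) = card {b \<in> B. z b \<le> t}"
      using True fin by (simp_all add: g_def sum.If_cases Int_def)
    then show ?thesis using le[OF True] by simp
  qed (simp add: g_def)
  ultimately have "(\<Sum>i\<in>I. max 0 (Z - y i)) \<le> q * (\<Sum>b\<in>B. max 0 (Z - z b))"
    by (rule has_integral_le)
  moreover have "(\<Sum>i\<in>I. Z - y i) \<le> (\<Sum>i\<in>I. max 0 (Z - y i))" by (rule sum_mono) simp
  moreover have "(\<Sum>b\<in>B. max 0 (Z - z b)) = (\<Sum>b\<in>B. Z - z b)" using z by (intro sum.cong) auto
  ultimately show ?thesis by simp
qed

text \<open>This is the function \<open>h\<close> of the introduction. For \<open>s < s'\<close> it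
  equals the power with exponent \<open>- s\<close> where 0 < |u| < 1 and the one with exponent
  \<open>- s'\<close> where |u| > 1. Since \<open>0 powr x = 0\<close>, its value at 0 is 0.\<close>

definition weight :: "real \<Rightarrow> real \<Rightarrow> real \<Rightarrow> real" where
  "weight s s' u = min (\<bar>u\<bar> powr - s) (\<bar>u\<bar> powr - s')"

text \<open>After taking logarithms, \<open>sum_gaps_le\<close> with \<open>Z\<close> the largest
  \<open>ln (v b)\<close> turns the product bound into a linear inequality for the
  \<open>ln (v b)\<close>. The scaling by \<open>p\<close> and the choice of \<open>s'\<close>
  spread the term \<open>card I * Z\<close> evenly over \<open>B\<close>.\<close>

lemma prod_weight_ge_1:
  fixes v :: "'b \<Rightarrow> real" and w :: "'a \<Rightarrow> real"
  assumes fin: "finite I" "finite B" and "B \<noteq> {}"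
    and v: "\<And>b. b \<in> B \<Longrightarrow> v b > 0" and w: "\<And>i. i \<in> I \<Longrightarrow> w i > 0"
    and le: "\<And>t. \<exists>b\<in>B. t < v b \<Longrightarrow>
      real (card {i \<in> I. w i \<le> t}) \<le> q * real (card {b \<in> B. v b \<le> t})"
    and prod: "(\<Prod>i\<in>I. w i) \<le> 1"
    and p: "p \<ge> 0" and s: "s \<ge> 0" "s = p * q" "s' = p * card I / card B" "s \<le> s'"
  shows "(\<Prod>b\<in>B. weight s s' (v b)) \<ge> 1"
proof -
  define Z where "Z = Max ((\<lambda>b. ln (v b)) ` B)"
  have Z: "\<And>b. b \<in> B \<Longrightarrow> ln (v b) \<le> Z" using fin by (auto simp: Z_def)
  have "Z \<in> (\<lambda>b. ln (v b)) ` B" unfolding Z_def using fin \<open>B \<noteq> {}\<close> by (intro Max_in) auto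
  then obtain b0 where b0: "b0 \<in> B" "Z = ln (v b0)" by auto
  have "(\<Sum>i\<in>I. Z - ln (w i)) \<le> q * (\<Sum>b\<in>B. Z - ln (v b))"
  proof (rule sum_gaps_le[OF fin Z])
    fix t assume t: "t < Z"
    have ln_le: "ln u \<le> t \<longleftrightarrow> u \<le> exp t" if "u > 0" for u
      using that by (metis exp_le_cancel_iff exp_ln)
    have "exp t < v b0" using t b0 v by (metis exp_less_cancel_iff exp_ln)
    then have "real (card {i \<in> I. w i \<le> exp t}) \<le> q * real (card {b \<in> B. v b \<le> exp t})"
      using b0 by (intro le) auto
    moreover have "{i \<in> I. ln (w i) \<le> t} = {i \<in> I. w i \<le> exp t}"
      using ln_le w by blast
    moreover have "{b \<in> B. ln (v b) \<le> t} = {b \<in> B. v b \<le> exp t}"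
      using ln_le v by blast
    ultimately show "real (card {i \<in> I. ln (w i) \<le> t}) \<le> q * real (card {b \<in> B. ln (v b) \<le> t})" by simp
  qed
  moreover have "(\<Sum>i\<in>I. ln (w i)) \<le> 0"
  proof -
    have "(\<Sum>i\<in>I. ln (w i)) = ln (\<Prod>i\<in>I. w i)" using w fin by (intro ln_prod[symmetric]) (auto simp: less_imp_neq[symmetric])
    moreover have "(\<Prod>i\<in>I. w i) > 0" using w by (simp add: prod_pos)
    ultimately show ?thesis using prod by simp
  qed
  ultimately have "card I * Z \<le> q * (\<Sum>b\<in>B. Z - ln (v b))"
    by (simp add: sum_subtractf)
  then have "p * (card I * Z) \<le> p * (q * (\<Sum>b\<in>B. Z - ln (v b)))"
    using p by (rule mult_left_mono)
  also have "p * (card I * Z) = (\<Sum>b\<in>B. s' * Z)"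
    using fin \<open>B \<noteq> {}\<close> by (simp add: s)
  also have "p * (q * (\<Sum>b\<in>B. Z - ln (v b))) = (\<Sum>b\<in>B. s * (Z - ln (v b)))"
    by (simp add: s sum_distrib_left mult_ac)
  finally have main: "(\<Sum>b\<in>B. s' * Z) \<le> (\<Sum>b\<in>B. s * (Z - ln (v b)))" .
  have s0: "s' \<ge> 0" using p by (simp add: s)
  \<comment> \<open>The logarithm of the product of weights is minus this sum.\<close>
  have "(\<Sum>b\<in>B. max (s * ln (v b)) (s' * ln (v b))) \<le> 0"
  proof (cases "Z \<ge> 0")
    case True
    \<comment> \<open>With l for \<open>ln (v b)\<close>, s l = s Z - s (Z - l) and s' l = s' Z - s'
      (Z - l). Both are at most s' Z - s (Z - l), because \<open>0 \<le> Z\<close>, l is at most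
      \<open>Z\<close>, and \<open>s \<le> s'\<close>.\<close>
    have "max (s * ln (v b)) (s' * ln (v b)) \<le> s' * Z - s * (Z - ln (v b))" if "b \<in> B" for b
    proof -
      have "s * (Z - ln (v b)) \<le> s' * (Z - ln (v b))" using Z[OF that] s by (intro mult_right_mono) auto
      moreover have "s * Z \<le> s' * Z" using True s by (intro mult_right_mono) auto
      ultimately show ?thesis by (simp add: algebra_simps)
    qed
    then have "(\<Sum>b\<in>B. max (s * ln (v b)) (s' * ln (v b))) \<le> (\<Sum>b\<in>B. s' * Z - s * (Z - ln (v b)))"
      by (rule sum_mono)
    then show ?thesis using main by (simp add: sum_subtractf)
  next
    case False
    have "max (s * ln (v b)) (s' * ln (v b)) \<le> 0" if "b \<in> B" for b
      using mult_nonneg_nonpos[OF s(1), of "ln (v b)"] mult_nonneg_nonpos[OF s0, of "ln (v b)"]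
        Z[OF that] False by linarith
    then show ?thesis by (rule sum_nonpos)
  qed
  then have "1 \<le> exp (- (\<Sum>b\<in>B. max (s * ln (v b)) (s' * ln (v b))))" by simp
  also have "\<dots> = (\<Prod>b\<in>B. exp (- max (s * ln (v b)) (s' * ln (v b))))"
    using fin by (simp flip: sum_negf exp_sum)
  also have "\<dots> = (\<Prod>b\<in>B. weight s s' (v b))"
  proof (rule prod.cong)
    fix b assume "b \<in> B"
    then have "v b > 0" by (rule v)
    then show "exp (- max (s * ln (v b)) (s' * ln (v b))) = weight s s' (v b)"
      by (simp add: weight_def powr_def min_def max_def)
  qed simp
  finally show ?thesis .
qed

section \<open>Integrability of products of weights\<close>

lemma weight_nonneg [simp]: "weight s s' u \<ge> 0"
  by (simp add: weight_def)

lemma weight_measurable [measurable]: "weight s s' \<in> borel_measurable borel"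
  unfolding weight_def by measurable

text \<open>The bound \<open>s < 1\<close> gives integrability near 0, and \<open>1 < s'\<close>
  gives it at infinity. The function \<open>g\<close> dominates the weight on the nonnegative
  half-line; the other half follows because the weight is even.\<close>

lemma nn_integral_weight_finite:
  assumes "0 < s" "s < 1" "1 < s'"
  shows "(\<integral>\<^sup>+x. ennreal (weight s s' x) \<partial>lborel) < \<infinity>"
proof -
  define g where "g x = ennreal (x powr - s) * indicator {0..1} x + ennreal (x powr - s') * indicator {1..} x"
    for x :: real
  have [measurable]: "g \<in> borel_measurable borel" unfolding g_def by measurable
  have "((\<lambda>x. x powr - s) has_integral (1 powr (- s + 1) / (- s + 1))) {0..1}"
    using assms by (intro has_integral_powr_from_0) auto
  then have "(\<integral>\<^sup>+x. ennreal (x powr - s) * indicator {0..1} x \<partial>lborel) < \<infinity>"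
    by (subst nn_integral_has_integral_lebesgue') auto
  moreover have "((\<lambda>x. x powr - s') has_integral (- (1 powr (- s' + 1)) / (- s' + 1))) {1..}"
    using assms by (intro has_integral_powr_to_inf) auto
  then have "(\<integral>\<^sup>+x. ennreal (x powr - s') * indicator {1..} x \<partial>lborel) < \<infinity>"
    by (subst nn_integral_has_integral_lebesgue') auto
  ultimately have g: "(\<integral>\<^sup>+x. g x \<partial>lborel) < \<infinity>"
    unfolding g_def by (subst nn_integral_add) auto
  moreover have "(\<integral>\<^sup>+x. g x \<partial>lborel) = (\<integral>\<^sup>+x. g (- x) \<partial>lborel)"
    using nn_integral_real_affine[of g "-1" 0] by simp
  ultimately have fin: "(\<integral>\<^sup>+x. g x + g (- x) \<partial>lborel) < \<infinity>"
    by (subst nn_integral_add) auto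
  have "ennreal (weight s s' x) \<le> g x + g (- x)" for x
  proof -
    have pos: "ennreal (weight s s' u) \<le> g u" if "u \<ge> 0" for u
    proof (cases "u \<le> 1")
      case True
      then have "ennreal (weight s s' u) \<le> ennreal (u powr - s) * indicator {0..1} u"
        using that by (simp add: weight_def ennreal_leI)
      then show ?thesis unfolding g_def by (rule add_increasing2[rotated]) simp
    next
      case False
      then have "ennreal (weight s s' u) \<le> ennreal (u powr - s') * indicator {1..} u"
        using that by (simp add: weight_def ennreal_leI)
      then show ?thesis unfolding g_def by (rule add_increasing[rotated]) simp
    qed
    have "weight s s' x = weight s s' (- x)" by (simp add: weight_def)
    then show ?thesis
      using pos[of x] pos[of "- x"] by (cases "x \<ge> 0") (auto intro: add_increasing2 add_increasing)
  qed
  then have "(\<integral>\<^sup>+x. ennreal (weight s s' x) \<partial>lborel) \<le> (\<integral>\<^sup>+x. g x + g (- x) \<partial>lborel)"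
    by (intro nn_integral_mono) auto
  with fin show ?thesis by (rule le_less_trans[rotated])
qed

lemma Basis_cart_eq_range: "(Basis :: (real ^ 'n) set) = range (\<lambda>i. axis i 1)"
  by (auto simp: Basis_vec_def)

lemma prod_Basis_cart:
  "(\<Prod>b\<in>Basis. f (x \<bullet> b)) = (\<Prod>i\<in>UNIV. f ((x :: real ^ 'n) $ i))"
proof -
  have "inj (\<lambda>i :: 'n. axis i (1 :: real))" by (auto simp: inj_on_def axis_eq_axis)
  then show ?thesis
    unfolding Basis_cart_eq_range using prod.reindex[of "\<lambda>i. axis i 1" UNIV "\<lambda>b. f (x \<bullet> b)"] by (simp add: inner_axis)
qed

text \<open>By Fubini the integral of the product is a product of one-dimensional integrals, and
  Markov's inequality at level 1 bounds the measure by it.\<close>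

lemma weight_superlevel_fmeasurable:
  assumes "0 < s" "s < 1" "1 < s'"
  shows "{y :: real ^ 'n. (\<Prod>i\<in>UNIV. weight s s' (y $ i)) \<ge> 1} \<in> fmeasurable lborel"
proof -
  define G :: "real ^ 'n \<Rightarrow> real" where "G y = (\<Prod>b\<in>Basis. weight s s' (y \<bullet> b))" for y
  have [measurable]: "G \<in> borel_measurable borel" unfolding G_def by measurable
  have "emeasure lborel {y \<in> space lborel. 1 \<le> ennreal (G y)} \<le> (\<integral>\<^sup>+y. ennreal (G y) \<partial>lborel)"
    using nn_integral_Markov_inequality[of "\<lambda>y. ennreal (G y)" UNIV lborel 1] by simp
  also have "(\<integral>\<^sup>+y. ennreal (G y) \<partial>lborel) = (\<integral>\<^sup>+y. (\<Prod>b\<in>Basis. ennreal (weight s s' (y \<bullet> b))) \<partial>(lborel :: (real ^ 'n) measure))"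
    by (simp add: G_def prod_ennreal)
  also have "\<dots> = (\<Prod>b\<in>(Basis :: (real ^ 'n) set). (\<integral>\<^sup>+x. ennreal (weight s s' x) \<partial>lborel))"
    by (intro nn_integral_lborel_prod) auto
  also have "\<dots> < \<infinity>"
    using nn_integral_weight_finite[OF assms] by (simp add: power_less_top_ennreal)
  finally have "emeasure lborel {y. 1 \<le> G y} < \<infinity>" by simp
  moreover have "{y. 1 \<le> G y} \<in> sets lborel" by measurable
  ultimately show ?thesis
    by (auto simp: fmeasurable_def G_def prod_Basis_cart)
qed

section \<open>Lebesgue measure under linear bijections\<close>

lemma nn_integral_lborel_shift:
  fixes c :: "'a::euclidean_space"
  assumes [measurable]: "h \<in> borel_measurable borel"
  shows "(\<integral>\<^sup>+x. h (c + x) \<partial>lborel) = (\<integral>\<^sup>+x. h x \<partial>lborel)"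
proof -
  have "(\<integral>\<^sup>+x. h x \<partial>lborel) = (\<integral>\<^sup>+x. h x \<partial>distr lborel borel ((+) c))"
    by (simp add: lborel_distr_plus)
  also have "\<dots> = (\<integral>\<^sup>+x. h (c + x) \<partial>lborel)" by (subst nn_integral_distr) auto
  finally show ?thesis by simp
qed

lemma nn_integral_lborel_reflect:
  fixes c :: "'a::euclidean_space"
  assumes [measurable]: "h \<in> borel_measurable borel"
  shows "(\<integral>\<^sup>+x. h (c - x) \<partial>lborel) = (\<integral>\<^sup>+x. h x \<partial>lborel)"
proof -
  have "distr lborel borel ((-) c) = lborel"
    by (subst lborel_affine[of "-1" c]) (auto simp: density_1)
  then have "(\<integral>\<^sup>+x. h x \<partial>lborel) = (\<integral>\<^sup>+x. h x \<partial>distr lborel borel ((-) c))" by simp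
  also have "\<dots> = (\<integral>\<^sup>+x. h (c - x) \<partial>lborel)" by (subst nn_integral_distr) auto
  finally show ?thesis by simp
qed

text \<open>
  The library computes the measure of a linear image only for index types in the class
  \<open>wellorder\<close>. This is the Fubini argument for the uniqueness of Haar measure, applied to the
  image of Lebesgue measure under \<open>f\<close>.
\<close>
lemma emeasure_linear_vimage_mult:
  fixes f :: "'a::euclidean_space \<Rightarrow> 'a"
  assumes f: "linear f" "inj f" and [measurable]: "A \<in> sets borel" "B \<in> sets borel"
  shows "emeasure lborel (f -` A) * emeasure lborel B = emeasure lborel A * emeasure lborel (f -` B)"
proof -
  obtain g where g: "linear g" "\<And>x. g (f x) = x" "\<And>x. f (g x) = x"
    using linear_injective_isomorphism[OF f] by blast
  have [measurable]: "f \<in> borel_measurable borel" "g \<in> borel_measurable borel"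
    using f g by (auto intro!: borel_measurable_continuous_onI linear_continuous_on simp: linear_linear)
  have [measurable]: "f -` A \<in> sets borel" "f -` B \<in> sets borel"
    using measurable_sets_borel[of f borel A] measurable_sets_borel[of f borel B] by auto
  let ?a = "indicator A :: 'a \<Rightarrow> ennreal" and ?b = "indicator B :: 'a \<Rightarrow> ennreal"
  have vA: "(\<integral>\<^sup>+x. ?a (f x) \<partial>lborel) = emeasure lborel (f -` A)"
    and vB: "(\<integral>\<^sup>+x. ?b (f x) \<partial>lborel) = emeasure lborel (f -` B)"
    by (simp_all flip: nn_integral_indicator add: indicator_vimage)
  have "emeasure lborel (f -` A) * emeasure lborel B = (\<integral>\<^sup>+y. (\<integral>\<^sup>+x. ?a (f x) \<partial>lborel) * ?b y \<partial>lborel)"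
    by (simp add: vA nn_integral_cmult)
  also have "\<dots> = (\<integral>\<^sup>+y. (\<integral>\<^sup>+x. ?a (f x) * ?b y \<partial>lborel) \<partial>lborel)"
    by (simp add: nn_integral_multc)
  also have "\<dots> = (\<integral>\<^sup>+y. (\<integral>\<^sup>+x. ?a (y + f x) * ?b y \<partial>lborel) \<partial>lborel)"
  proof (rule nn_integral_cong)
    \<comment> \<open>Translating \<open>x\<close> by \<open>g y\<close> replaces \<open>f x\<close>
      by \<open>y + f x\<close>. Once the integrals are exchanged, translating \<open>y\<close>
      moves \<open>f\<close> from the argument of \<open>A\<close> to that of
      \<open>B\<close>.\<close>
    fix y
    have "f (g y + x) = y + f x" for x using f g by (simp add: linear_add)
    then show "(\<integral>\<^sup>+x. ?a (f x) * ?b y \<partial>lborel) = (\<integral>\<^sup>+x. ?a (y + f x) * ?b y \<partial>lborel)"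
      using nn_integral_lborel_shift[of "\<lambda>x. ?a (f x) * ?b y" "g y"] by simp
  qed
  also have "\<dots> = (\<integral>\<^sup>+x. (\<integral>\<^sup>+y. ?a (y + f x) * ?b y \<partial>lborel) \<partial>lborel)"
    by (rule lborel_pair.Fubini') measurable
  also have "\<dots> = (\<integral>\<^sup>+x. (\<integral>\<^sup>+y. ?a y * ?b (y - f x) \<partial>lborel) \<partial>lborel)"
  proof (rule nn_integral_cong)
    fix x
    show "(\<integral>\<^sup>+y. ?a (y + f x) * ?b y \<partial>lborel) = (\<integral>\<^sup>+y. ?a y * ?b (y - f x) \<partial>lborel)"
      using nn_integral_lborel_shift[of "\<lambda>y. ?a y * ?b (y - f x)" "f x"] by (simp add: add.commute)
  qed
  also have "\<dots> = (\<integral>\<^sup>+y. (\<integral>\<^sup>+x. ?a y * ?b (y - f x) \<partial>lborel) \<partial>lborel)"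
    by (rule lborel_pair.Fubini'[symmetric]) measurable
  also have "\<dots> = (\<integral>\<^sup>+y. ?a y * emeasure lborel (f -` B) \<partial>lborel)"
  proof (rule nn_integral_cong)
    fix y
    have "y - f x = f (g y - x)" for x using f g by (simp add: linear_diff)
    then have "(\<integral>\<^sup>+x. ?b (y - f x) \<partial>lborel) = emeasure lborel (f -` B)"
      using nn_integral_lborel_reflect[of "\<lambda>x. ?b (f x)" "g y"] vB by simp
    then show "(\<integral>\<^sup>+x. ?a y * ?b (y - f x) \<partial>lborel) = ?a y * emeasure lborel (f -` B)"
      by (simp add: nn_integral_cmult)
  qed
  also have "\<dots> = emeasure lborel A * emeasure lborel (f -` B)"
    by (simp add: nn_integral_multc)
  finally show ?thesis .
qed

text \<open>Comparison with the unit cube determines \<open>c\<close>, which is the reciprocal of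
  |det f|; the applications need only that it is positive and finite. It is finite because the
  preimage of the cube is bounded, and nonzero because otherwise the whole space would be
  null.\<close>

lemma emeasure_linear_vimage:
  fixes f :: "'a::euclidean_space \<Rightarrow> 'a"
  assumes f: "linear f" "inj f"
  obtains c where "0 < c" "c < \<infinity>"
    "\<And>A. A \<in> sets borel \<Longrightarrow> emeasure lborel (f -` A) = emeasure lborel A * c"
proof -
  define c where "c = emeasure lborel (f -` cbox 0 One)"
  have eq: "emeasure lborel (f -` A) = emeasure lborel A * c" if "A \<in> sets borel" for A
    using emeasure_linear_vimage_mult[OF f that, of "cbox 0 One"]
    by (simp add: c_def emeasure_lborel_cbox_eq)
  obtain g where g: "linear g" "\<And>x. g (f x) = x" "\<And>x. f (g x) = x"
    using linear_injective_isomorphism[OF f] by blast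
  then have "f -` cbox 0 One = g ` cbox 0 One" by (auto simp: image_iff) metis
  then have "bounded (f -` cbox 0 One)"
    using bounded_linear_image[of "cbox 0 One" g] g by (simp add: linear_linear)
  then have "c < \<infinity>" unfolding c_def by (rule emeasure_bounded_finite)
  moreover have "c \<noteq> 0"
  proof
    assume "c = 0"
    then have "emeasure lborel (UNIV :: 'a set) = 0" using eq[of UNIV] by simp
    then show False by simp
  qed
  ultimately show ?thesis using eq that zero_less_iff_neq_zero by blast
qed

lemma lmeasurable_linear_vimage:
  fixes f :: "'a::euclidean_space \<Rightarrow> 'a"
  assumes f: "linear f" "inj f" and S: "S \<in> fmeasurable lborel"
  shows "f -` S \<in> lmeasurable"
proof -
  obtain c where c: "c < \<infinity>" "\<And>A. A \<in> sets borel \<Longrightarrow> emeasure lborel (f -` A) = emeasure lborel A * c"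
    using emeasure_linear_vimage[OF f] by blast
  have S': "S \<in> sets borel" "emeasure lborel S < \<infinity>" using S by (auto simp: fmeasurable_def)
  have "f \<in> borel_measurable borel"
    using f by (auto intro!: borel_measurable_continuous_onI linear_continuous_on simp: linear_linear)
  then have "f -` S \<in> sets borel" using measurable_sets_borel[of f borel S] S' by simp
  moreover have "emeasure lborel (f -` S) < \<infinity>"
    using c S' by (simp add: ennreal_mult_less_top)
  ultimately show ?thesis by (simp add: fmeasurable_def)
qed

section \<open>The volume bound from the counting condition\<close>

text \<open>In the application \<open>a i\<close> and \<open>b i\<close> are the real and imaginary
  parts of \<open>L i\<close>, and \<open>g i x\<close> is the absolute value of the form at
  \<open>x\<close>. The covering set \<open>T\<close> consists of finitely many hyperplanes and
  finitely many linear preimages of one superlevel set \<open>W\<close>.\<close>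

lemma finite_volume_of_subspace_bound:
  fixes a b :: "'a \<Rightarrow> real ^ 'n" and g :: "'a \<Rightarrow> real ^ 'n \<Rightarrow> real"
  assumes n: "CARD('n) \<ge> 2" and I: "finite I" "I \<noteq> {}"
    and nz: "\<And>i. i \<in> I \<Longrightarrow> a i \<noteq> 0 \<or> b i \<noteq> 0"
    and bound: "\<And>U. subspace U \<Longrightarrow> 0 < dim U \<Longrightarrow> dim U < CARD('n) \<Longrightarrow>
      card {i \<in> I. a i \<in> U \<and> b i \<in> U} * CARD('n) < card I * dim U"
    and g: "\<And>i x. i \<in> I \<Longrightarrow> max \<bar>a i \<bullet> x\<bar> \<bar>b i \<bullet> x\<bar> \<le> g i x"
  shows "\<exists>T \<in> lmeasurable. {x. (\<Prod>i\<in>I. g i x) \<le> 1} \<subseteq> T"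
proof -
  define n d where "n = CARD('n)" and "d = card I"
  have d: "d \<ge> 1" using I by (simp add: d_def Suc_leI card_gt_0_iff)
  have n2: "n \<ge> 2" using n by (simp add: n_def)
  \<comment> \<open>The inequality in \<open>bound\<close> is between integers, so it holds with a
    gap of 1. Divided by n and using that \<open>dim U\<close> is at most n, the gap lowers the
    slope from d / n to \<open>q\<close>.\<close>
  define q where "q = d / n - 1 / (n * n)"
  have "1 < d * n" using d n2 by (metis One_nat_def Suc_1 Suc_le_lessD mult_le_mono mult_1)
  then have "1 < real d * n" by (metis of_nat_1 of_nat_less_iff of_nat_mult)
  moreover have "q = (real d * n - 1) / (n * n)" using n2 by (simp add: q_def field_simps)
  ultimately have q: "q > 0" using n2 by simp
  have bound': "real (card {i \<in> I. a i \<in> U \<and> b i \<in> U}) \<le> q * dim U" (is "real ?m \<le> _")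
    if U: "subspace U" "dim U < n" for U
  proof (cases "dim U = 0")
    case True
    then have "U \<subseteq> {0}" by simp
    then have empty: "{i \<in> I. a i \<in> U \<and> b i \<in> U} = {}" using nz by blast
    show ?thesis unfolding empty using q by simp
  next
    case False
    then have "?m * n + 1 \<le> d * dim U"
      using bound[OF U(1)] U(2) unfolding n_def d_def by linarith
    then have "real (?m * n + 1) \<le> real (d * dim U)" by (simp only: of_nat_le_iff)
    then have "real ?m * n + 1 \<le> real d * dim U" by simp
    then have "real ?m \<le> (real d * dim U - 1) / n" using n2 by (simp add: field_simps)
    also have "\<dots> = dim U * (d / n) - 1 / n" by (simp add: diff_divide_distrib)
    also have "\<dots> \<le> dim U * (d / n) - dim U / (n * n)"
      using U n2 by (simp add: field_simps)
    finally show ?thesis by (simp add: q_def algebra_simps)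
  qed
  define R where "R = (a ` I \<union> b ` I) - {0}"
  have finR: "finite R" using I by (simp add: R_def)
  have R: "r \<in> R \<or> r = 0" if "r \<in> a ` I \<union> b ` I" for r using that by (auto simp: R_def)
  have spanR: "span R = UNIV"
  proof (rule ccontr)
    assume "span R \<noteq> UNIV"
    then have "dim (span R) < n"
      using dim_eq_full[of R] dim_subset_UNIV[of R] by (simp add: n_def less_le)
    moreover have "r \<in> span R" if "r \<in> a ` I \<union> b ` I" for r
      using R[OF that] by (auto intro: span_base span_0)
    then have "{i \<in> I. a i \<in> span R \<and> b i \<in> span R} = I" by auto
    ultimately have "real d \<le> q * dim (span R)"
      using bound'[of "span R"] by (simp add: d_def)
    also have "\<dots> \<le> q * n" using q \<open>dim (span R) < n\<close> by (intro mult_left_mono) auto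
    also have "\<dots> < d" using n2 by (simp add: q_def field_simps)
    finally show False by simp
  qed
  \<comment> \<open>Outside this null set all \<open>\<bar>r \<bullet> x\<bar>\<close> with
    \<open>r \<in> R\<close> are positive, as the logarithms in \<open>prod_weight_ge_1\<close>
    require. Each set in the union is a genuine hyperplane because 0 was removed from
    \<open>R\<close>.\<close>
  define N where "N = (\<Union>r\<in>R. {x. r \<bullet> x = 0})"
  have N: "negligible N"
    unfolding N_def using finR by (intro negligible_Union) (auto intro!: negligible_hyperplane simp: R_def)
  \<comment> \<open>Since \<open>q\<close> is strictly below d / n, some \<open>p\<close> satisfies
    p q < 1 < p d / n. These two products are the exponents \<open>s\<close> and \<open>s'\<close>
    of an integrable weight.\<close>
  have "n / d < 1 / q"
    using q n2 d by (simp add: q_def field_simps)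
  then obtain p where p: "n / d < p" "p < 1 / q" using dense by blast
  define s where "s = p * q"
  define s' where "s' = p * d / n"
  have "n / d > 0" using n2 d by simp
  then have p0: "p > 0" using p by linarith
  have s: "0 < s" "s < 1" "1 < s'"
    using p p0 q n2 d by (simp_all add: s_def s'_def field_simps)
  define W :: "(real ^ 'n) set" where "W = {y. (\<Prod>i\<in>UNIV. weight s s' (y $ i)) \<ge> 1}"
  have W: "W \<in> fmeasurable lborel" unfolding W_def using s by (rule weight_superlevel_fmeasurable)
  \<comment> \<open>The rows of such a matrix form a basis taken from \<open>R\<close>. There are
    finitely many, which is why the basis may depend on the point \<open>x\<close>.\<close>
  define \<M> where "\<M> = {M :: real ^ 'n ^ 'n. (\<forall>i. M $ i \<in> R) \<and> inj ((*v) M)}"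
  have "finite {M :: real ^ 'n ^ 'n. \<forall>i. M $ i \<in> R}"
  proof (rule finite_subset)
    show "finite ((\<lambda>f. \<chi> i. f i) ` (UNIV \<rightarrow>\<^sub>E R) :: (real ^ 'n ^ 'n) set)"
      using finR by (intro finite_imageI finite_PiE) auto
    show "{M :: real ^ 'n ^ 'n. \<forall>i. M $ i \<in> R} \<subseteq> (\<lambda>f. \<chi> i. f i) ` (UNIV \<rightarrow>\<^sub>E R)"
    proof
      fix M :: "real ^ 'n ^ 'n" assume "M \<in> {M. \<forall>i. M $ i \<in> R}"
      then have "M = (\<chi> i. M $ i)" "($) M \<in> UNIV \<rightarrow>\<^sub>E R" by (auto simp: vec_eq_iff)
      then show "M \<in> (\<lambda>f. \<chi> i. f i) ` (UNIV \<rightarrow>\<^sub>E R)" by (rule image_eqI[where x = "($) M"])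
    qed
  qed
  then have fM: "finite \<M>" by (rule rev_finite_subset) (auto simp: \<M>_def)
  define T where "T = N \<union> (\<Union>M\<in>\<M>. (*v) M -` W)"
  have "(*v) M -` W \<in> lmeasurable" if "M \<in> \<M>" for M
    using that W by (intro lmeasurable_linear_vimage) (auto simp: \<M>_def)
  then have "T \<in> lmeasurable"
    unfolding T_def using N fM
    by (intro fmeasurable.Un fmeasurable.finite_UN) (auto simp: negligible_imp_measurable)
  moreover have "{x. (\<Prod>i\<in>I. g i x) \<le> 1} \<subseteq> T"
  proof
    fix x assume "x \<in> {x. (\<Prod>i\<in>I. g i x) \<le> 1}"
    then have x: "(\<Prod>i\<in>I. g i x) \<le> 1" by simp
    show "x \<in> T"
    proof (cases "x \<in> N")
      case False
      define v where "v r = \<bar>r \<bullet> x\<bar>" for r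
      have v: "v r > 0" if "r \<in> R" for r using False that by (auto simp: v_def N_def)
      obtain B where B: "B \<subseteq> R" "independent B" "card B = n"
        and greedy: "\<And>r. r \<in> R \<Longrightarrow> r \<in> span {b \<in> B. v b \<le> v r}"
        using exists_min_weight_basis[OF finR spanR, of v] by (auto simp: n_def)
      have finB: "finite B" using B finR finite_subset by blast
      define w where "w i = max (v (a i)) (v (b i))" for i
      have w: "w i > 0" if "i \<in> I" for i
        using nz[OF that] v[of "a i"] v[of "b i"] that by (auto simp: w_def R_def)
      have "(\<Prod>b\<in>B. weight s s' (v b)) \<ge> 1"
      proof (rule prod_weight_ge_1[where I = I and w = w and p = p and q = q])
        show "B \<noteq> {}" using B n2 by auto
        show "s' = p * real (card I) / real (card B)" by (simp add: s'_def B d_def)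
        have "(\<Prod>i\<in>I. w i) \<le> (\<Prod>i\<in>I. g i x)"
          using w g by (intro prod_mono) (auto simp: w_def v_def less_imp_le)
        then show "(\<Prod>i\<in>I. w i) \<le> 1" using x by simp
        fix t assume t: "\<exists>b\<in>B. t < v b"
        \<comment> \<open>By the greedy property every \<open>a i\<close> or \<open>b i\<close> of
          size at most \<open>t\<close> at \<open>x\<close> lies in the span of \<open>C\<close>.
          This span is proper because \<open>b0\<close> is missing, so the counting bound applies to
          it.\<close>
        define C where "C = {b \<in> B. v b \<le> t}"
        obtain b0 where b0: "b0 \<in> B" "t < v b0" using t by blast
        then have "b0 \<notin> C" by (simp add: C_def)
        moreover have "C \<subseteq> B" by (auto simp: C_def)
        ultimately have "C \<subset> B" using b0 by blast
        then have "card C < n" using psubset_card_mono[OF finB] B by simp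
        moreover have dimC: "dim (span C) = card C"
          using independent_mono[OF B(2)] \<open>C \<subset> B\<close> by (simp add: dim_eq_card_independent psubset_imp_subset)
        moreover have "{i \<in> I. w i \<le> t} \<subseteq> {i \<in> I. a i \<in> span C \<and> b i \<in> span C}"
        proof -
          have "r \<in> span C" if "r \<in> a ` I \<union> b ` I" "v r \<le> t" for r
          proof (cases "r = 0")
            case False
            then have "r \<in> span {b \<in> B. v b \<le> v r}" using R[OF that(1)] greedy by blast
            moreover have "{b \<in> B. v b \<le> v r} \<subseteq> C" using that by (auto simp: C_def)
            ultimately show ?thesis using span_mono by blast
          qed (simp add: span_0)
          then show ?thesis by (auto simp: w_def)
        qed
        then have "card {i \<in> I. w i \<le> t} \<le> card {i \<in> I. a i \<in> span C \<and> b i \<in> span C}"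
          using I by (intro card_mono) auto
        ultimately have "real (card {i \<in> I. w i \<le> t}) \<le> q * card C"
          using bound'[of "span C"] by simp
        then show "real (card {i \<in> I. w i \<le> t}) \<le> q * real (card {b \<in> B. v b \<le> t})"
          by (simp add: C_def)
      qed (use I finB v B w p0 s in \<open>auto simp: s_def\<close>)
      moreover obtain f where f: "bij_betw f (UNIV :: 'n set) B"
        using finite_same_card_bij[of "UNIV :: 'n set" B] finB B by (auto simp: n_def)
      define M where "M = (\<chi> i. f i)"
      have "(\<Prod>b\<in>B. weight s s' (v b)) = (\<Prod>i\<in>UNIV. weight s s' ((M *v x) $ i))"
        by (subst prod.reindex_bij_betw[OF f, symmetric])
           (simp add: M_def matrix_vector_mul_component v_def weight_def)
      ultimately have "M *v x \<in> W" by (simp add: W_def)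
      moreover have "M \<in> \<M>"
      proof -
        have "M $ i \<in> R" for i using f B by (auto simp: M_def bij_betw_def)
        moreover have "inj ((*v) M)"
        proof -
          have "y = 0" if "M *v y = 0" for y
          proof -
            have "f i \<bullet> y = 0" for i
              using that matrix_vector_mul_component[of M y i] by (simp add: M_def)
            then have "r \<bullet> y = 0" if "r \<in> B" for r
              using f that by (auto simp: bij_betw_def)
            moreover have "span B = UNIV"
              using B finB
              by (metis dim_eq_card_independent dim_eq_full n_def DIM_cart DIM_real mult.right_neutral)
            ultimately show ?thesis
              using orthogonal_to_span[of y B y] by (auto simp: orthogonal_def inner_commute)
          qed
          then show ?thesis by (simp add: linear_injective_0)
        qed
        ultimately show ?thesis by (simp add: \<M>_def)
      qed
      ultimately show ?thesis by (auto simp: T_def)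
    qed (simp add: T_def)
  qed
  ultimately show ?thesis by blast
qed

section \<open>Infinite volume\<close>

text \<open>The vectors \<open>r\<close> that admit such a constant form a subspace, and each
  \<open>f j\<close> admits the constant 1.\<close>

lemma span_inner_bound:
  assumes "r \<in> span (f ` J)"
  obtains C where "C \<ge> 0" "\<And>x e. e \<ge> 0 \<Longrightarrow> (\<And>j. j \<in> J \<Longrightarrow> \<bar>f j \<bullet> x\<bar> \<le> e) \<Longrightarrow> \<bar>r \<bullet> x\<bar> \<le> C * e"
proof -
  let ?P = "\<lambda>r C. C \<ge> 0 \<and> (\<forall>x e. e \<ge> 0 \<longrightarrow> (\<forall>j\<in>J. \<bar>f j \<bullet> x\<bar> \<le> e) \<longrightarrow> \<bar>r \<bullet> x\<bar> \<le> C * e)"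
  have "subspace {r. \<exists>C. ?P r C}"
  proof (rule subspaceI)
    show "0 \<in> {r. \<exists>C. ?P r C}" by (auto intro!: exI[of _ 0])
  next
    fix r s assume "r \<in> {r. \<exists>C. ?P r C}" "s \<in> {r. \<exists>C. ?P r C}"
    then obtain C D where CD: "?P r C" "?P s D" by blast
    have "?P (r + s) (C + D)"
    proof (intro conjI allI impI)
      fix x e assume "e \<ge> 0" "\<forall>j\<in>J. \<bar>f j \<bullet> x\<bar> \<le> e"
      then have "\<bar>r \<bullet> x\<bar> \<le> C * e" "\<bar>s \<bullet> x\<bar> \<le> D * e" using CD by blast+
      then show "\<bar>(r + s) \<bullet> x\<bar> \<le> (C + D) * e" by (simp add: inner_add_left distrib_right)
    qed (use CD in simp)
    then show "r + s \<in> {r. \<exists>C. ?P r C}" by blast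
  next
    fix c r assume "r \<in> {r. \<exists>C. ?P r C}"
    then obtain C where C: "?P r C" by blast
    have "?P (c *\<^sub>R r) (\<bar>c\<bar> * C)"
    proof (intro conjI allI impI)
      fix x e assume "e \<ge> 0" "\<forall>j\<in>J. \<bar>f j \<bullet> x\<bar> \<le> e"
      then have "\<bar>r \<bullet> x\<bar> \<le> C * e" using C by blast
      then show "\<bar>(c *\<^sub>R r) \<bullet> x\<bar> \<le> \<bar>c\<bar> * C * e"
        by (simp add: abs_mult mult.assoc mult_left_mono)
    qed (use C in simp)
    then show "c *\<^sub>R r \<in> {r. \<exists>C. ?P r C}" by blast
  qed
  moreover have "f ` J \<subseteq> {r. \<exists>C. ?P r C}" by (auto intro!: exI[of _ 1])
  ultimately have "span (f ` J) \<subseteq> {r. \<exists>C. ?P r C}" by (rule span_minimal[rotated])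
  then obtain C where "?P r C" using assms by blast
  then show ?thesis using that by blast
qed

lemma span_inner_bound_finite:
  fixes f :: "'b \<Rightarrow> 'a::real_inner"
  assumes "finite A" "A \<subseteq> span (f ` J)"
  obtains C where "C \<ge> 0" "\<And>r x e. r \<in> A \<Longrightarrow> e \<ge> 0 \<Longrightarrow> (\<And>j. j \<in> J \<Longrightarrow> \<bar>f j \<bullet> x\<bar> \<le> e) \<Longrightarrow> \<bar>r \<bullet> x\<bar> \<le> C * e"
proof -
  have "\<forall>r\<in>A. \<exists>C. C \<ge> 0 \<and> (\<forall>x e. e \<ge> 0 \<longrightarrow> (\<forall>j\<in>J. \<bar>f j \<bullet> x\<bar> \<le> e) \<longrightarrow> \<bar>r \<bullet> x\<bar> \<le> C * e)"
  proof
    fix r assume "r \<in> A"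
    then have "r \<in> span (f ` J)" using assms by blast
    then show "\<exists>C. C \<ge> 0 \<and> (\<forall>x e. e \<ge> 0 \<longrightarrow> (\<forall>j\<in>J. \<bar>f j \<bullet> x\<bar> \<le> e) \<longrightarrow> \<bar>r \<bullet> x\<bar> \<le> C * e)"
      by (rule span_inner_bound) blast
  qed
  then obtain C where C: "\<And>r. r \<in> A \<Longrightarrow> C r \<ge> 0"
    "\<And>r x e. r \<in> A \<Longrightarrow> e \<ge> 0 \<Longrightarrow> (\<forall>j\<in>J. \<bar>f j \<bullet> x\<bar> \<le> e) \<Longrightarrow> \<bar>r \<bullet> x\<bar> \<le> C r * e"
    by metis
  show ?thesis
  proof (rule that[of "\<Sum>r\<in>A. C r"])
    show "(\<Sum>r\<in>A. C r) \<ge> 0" using C by (simp add: sum_nonneg)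
    fix r x and e :: real assume *: "r \<in> A" "e \<ge> 0" "\<And>j. j \<in> J \<Longrightarrow> \<bar>f j \<bullet> x\<bar> \<le> e"
    have "\<bar>r \<bullet> x\<bar> \<le> C r * e" using * C by blast
    also have "C r \<le> (\<Sum>r\<in>A. C r)" using * C assms by (intro member_le_sum) auto
    finally show "\<bar>r \<bullet> x\<bar> \<le> (\<Sum>r\<in>A. C r) * e" using * by (simp add: mult_right_mono)
  qed
qed

text \<open>The coordinates are the inner products with a basis extending one of \<open>U\<close>;
  the indices in \<open>K\<close> belong to \<open>U\<close>. One coordinate \<open>j0\<close>
  outside \<open>K\<close>, available because \<open>U\<close> is proper, keeps the boxes
  apart.\<close>

lemma infinite_volume_of_subspace:
  fixes a b :: "'a \<Rightarrow> real ^ 'n" and g :: "'a \<Rightarrow> real ^ 'n \<Rightarrow> real"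
  assumes I: "finite I" "I \<noteq> {}" and U: "subspace U" "0 < dim U" "dim U < CARD('n)"
    and bound: "card I * dim U \<le> card {i \<in> I. a i \<in> U \<and> b i \<in> U} * CARD('n)"
    and g: "\<And>i x. i \<in> I \<Longrightarrow> 0 \<le> g i x" "\<And>i x. i \<in> I \<Longrightarrow> g i x \<le> \<bar>a i \<bullet> x\<bar> + \<bar>b i \<bullet> x\<bar>"
    and S: "{x. (\<Prod>i\<in>I. g i x) \<le> 1} \<in> sets borel"
  shows "emeasure lborel {x. (\<Prod>i\<in>I. g i x) \<le> 1} = \<infinity>"
proof -
  define n d k where "n = CARD('n)" and "d = card I" and "k = dim U"
  define IU where "IU = {i \<in> I. a i \<in> U \<and> b i \<in> U}"
  define m where "m = card IU"
  have IU: "IU \<subseteq> I" "finite IU" using I by (auto simp: IU_def)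
  have "m \<le> d" unfolding m_def d_def by (rule card_mono[OF I(1) IU(1)])
  have "d > 0" using I by (simp add: d_def card_gt_0_iff)
  have "k > 0" "k < n" using U by (simp_all add: k_def n_def)
  have bnd: "d * k \<le> m * n" using bound by (simp add: d_def k_def m_def n_def IU_def)
  have "0 < d * k" using \<open>d > 0\<close> \<open>k > 0\<close> by simp
  then have "m > 0" using bnd by (metis gr0I leD mult_0)
  \<comment> \<open>The exponent solves \<alpha> m = d - m: shrinking the m forms in
    \<open>U\<close> by \<open>E t powr - \<alpha>\<close> exactly compensates growth of the other d
    - m forms by \<open>E t\<close>.\<close>
  define \<alpha> where "\<alpha> = (real d - m) / m"
  have \<alpha>: "\<alpha> \<ge> 0" using \<open>m \<le> d\<close> by (simp add: \<alpha>_def)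

  obtain B where B: "B \<subseteq> U" "independent B" "U \<subseteq> span B" "card B = k"
    unfolding k_def by (rule basis_exists[of U])
  obtain B' where B': "B \<subseteq> B'" "independent B'" "span B' = UNIV"
    using maximal_independent_subset_extend[OF subset_UNIV B(2)] by (metis top.extremum_uniqueI)
  have finB': "finite B'" using B' independent_imp_finite by blast
  have "card B' = n"
    using B' dim_eq_card_independent[of B'] dim_span[of B'] by (simp add: n_def)
  then obtain f where f: "bij_betw f (UNIV :: 'n set) B'"
    using finite_same_card_bij[of "UNIV :: 'n set" B'] finB' by (auto simp: n_def)
  define K where "K = {j. f j \<in> B}"
  have fK: "f ` K = B" using f B' by (auto simp: K_def bij_betw_def)
  have "card K = k"
    using card_image[of f K] fK f B by (auto simp: bij_betw_def inj_on_def)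
  have "K \<noteq> UNIV" using \<open>card K = k\<close> \<open>k < n\<close> by (auto simp: n_def)
  then obtain j0 where j0: "j0 \<notin> K" by blast
  define M where "M = (\<chi> i. f i)"
  have M: "(M *v x) $ i = f i \<bullet> x" for x i by (simp add: M_def matrix_vector_mul_component)
  have injM: "inj ((*v) M)"
  proof -
    have "y = 0" if "M *v y = 0" for y
    proof -
      have "f i \<bullet> y = 0" for i using that M[of y i] by simp
      then have "r \<bullet> y = 0" if "r \<in> B'" for r using f that by (auto simp: bij_betw_def)
      then show ?thesis
        using orthogonal_to_span[of y B' y] B' by (auto simp: orthogonal_def inner_commute)
    qed
    then show ?thesis by (simp add: linear_injective_0)
  qed

  have "a ` IU \<union> b ` IU \<subseteq> U" by (auto simp: IU_def)
  then have A1: "finite (a ` IU \<union> b ` IU)" "a ` IU \<union> b ` IU \<subseteq> span (f ` K)"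
    using IU B unfolding fK by (simp, blast)
  obtain C1 where C1: "C1 \<ge> 0" "\<And>r x e. r \<in> a ` IU \<union> b ` IU \<Longrightarrow> e \<ge> 0 \<Longrightarrow>
      (\<And>j. j \<in> K \<Longrightarrow> \<bar>f j \<bullet> x\<bar> \<le> e) \<Longrightarrow> \<bar>r \<bullet> x\<bar> \<le> C1 * e"
    by (rule span_inner_bound_finite[OF A1]) blast
  have "range f = B'" using f by (simp add: bij_betw_def)
  then have A2: "finite (a ` I \<union> b ` I)" "a ` I \<union> b ` I \<subseteq> span (f ` UNIV)" using I B' by auto
  obtain C2 where C2: "C2 \<ge> 0" "\<And>r x e. r \<in> a ` I \<union> b ` I \<Longrightarrow> e \<ge> 0 \<Longrightarrow>
      (\<And>j. j \<in> UNIV \<Longrightarrow> \<bar>f j \<bullet> x\<bar> \<le> e) \<Longrightarrow> \<bar>r \<bullet> x\<bar> \<le> C2 * e"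
    by (rule span_inner_bound_finite[OF A2]) blast
  define C where "C = 2 * (C1 + C2) + 1"
  have C: "C \<ge> 1" using C1(1) C2(1) by (simp add: C_def)
  have gIU: "g i x \<le> C * e" if "i \<in> IU" "e \<ge> 0" "\<And>j. j \<in> K \<Longrightarrow> \<bar>f j \<bullet> x\<bar> \<le> e" for i x e
  proof -
    have "\<bar>a i \<bullet> x\<bar> \<le> C1 * e" "\<bar>b i \<bullet> x\<bar> \<le> C1 * e" using that by (auto intro!: C1(2))
    then have "g i x \<le> 2 * (C1 * e)" using g(2)[of i x] that IU by auto
    also have "2 * (C1 * e) \<le> C * e"
      using C2(1) that(2) by (simp add: C_def algebra_simps)
    finally show ?thesis .
  qed
  have gI: "g i x \<le> C * e" if "i \<in> I" "e \<ge> 0" "\<And>j. \<bar>f j \<bullet> x\<bar> \<le> e" for i x e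
  proof -
    have "\<bar>a i \<bullet> x\<bar> \<le> C2 * e" "\<bar>b i \<bullet> x\<bar> \<le> C2 * e" using that by (auto intro!: C2(2))
    then have "g i x \<le> 2 * (C2 * e)" using g(2)[of i x] that by auto
    also have "2 * (C2 * e) \<le> C * e"
      using C1(1) that(2) by (simp add: C_def algebra_simps)
    finally show ?thesis .
  qed

  \<comment> \<open>The factor \<open>c\<close> absorbs the constant \<open>(2 * C) ^ d\<close> in
    the product of all forms. It occurs there to the power m, which is enough because
    \<open>c \<le> 1\<close> and m is positive.\<close>
  define c where "c = 1 / (2 * C) ^ d"
  have "(2 * C) ^ d \<ge> 1" using C by (intro one_le_power) simp
  then have c: "0 < c" "c \<le> 1" "c * (2 * C) ^ d = 1" using C by (auto simp: c_def)
  define E where "E t = (2 :: real) ^ t" for t :: nat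
  define P where "P t = E t powr - \<alpha>" for t
  have E: "E t \<ge> 1" for t by (simp add: E_def)
  have P: "P t > 0" "P t \<le> 1" for t
    using E[of t] \<alpha> powr_mono[of "- \<alpha>" 0 "E t"] by (auto simp: P_def)
  have PE: "P t ^ i * E t ^ j = E t powr (- \<alpha> * i + j)" for t i j
  proof -
    have "P t ^ i * E t ^ j = E t powr (- \<alpha> * i) * E t powr j"
      using E[of t] P(1)[of t] by (simp add: P_def powr_powr flip: powr_realpow)
    then show ?thesis by (simp only: powr_add)
  qed
  \<comment> \<open>The coordinate \<open>j0\<close> stays between \<open>E t\<close> and
    \<open>3 / 2 * E t\<close>, hence below \<open>E (Suc t) = 2 * E t\<close>; this makes the boxes
    disjoint.\<close>
  define lo where "lo t = (\<chi> j. if j \<in> K then - (c * P t) else if j = j0 then E t else - E t)" for t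
  define hi where "hi t = (\<chi> j. if j \<in> K then c * P t else if j = j0 then 3 / 2 * E t else E t)" for t
  define D where "D t = cbox (lo t) (hi t :: real ^ 'n)" for t

  have D_sub: "(*v) M -` D t \<subseteq> {x. (\<Prod>i\<in>I. g i x) \<le> 1}" for t
  proof safe
    fix x assume "M *v x \<in> D t"
    then have x: "lo t $ j \<le> f j \<bullet> x" "f j \<bullet> x \<le> hi t $ j" for j
      by (auto simp: D_def mem_box_cart M)
    have inK: "\<bar>f j \<bullet> x\<bar> \<le> c * P t" if "j \<in> K" for j
      using x[of j] that by (auto simp: lo_def hi_def)
    have "c * P t \<le> 1 * 1" using c P[of t] by (intro mult_mono) auto
    then have all: "\<bar>f j \<bullet> x\<bar> \<le> 2 * E t" for j
      using x[of j] E[of t] by (auto simp: lo_def hi_def split: if_splits)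
    have "(\<Prod>i\<in>I. g i x) = (\<Prod>i\<in>IU. g i x) * (\<Prod>i\<in>I - IU. g i x)"
      using I IU by (metis mult.commute prod.subset_diff)
    also have "\<dots> \<le> (\<Prod>i\<in>IU. C * (c * P t)) * (\<Prod>i\<in>I - IU. C * (2 * E t))"
    proof (intro mult_mono prod_mono conjI)
      show "(\<Prod>i\<in>IU. C * (c * P t)) \<ge> 0" using C c P[of t] by (intro prod_nonneg) auto
      show "(\<Prod>i\<in>I - IU. g i x) \<ge> 0" using g by (intro prod_nonneg) auto
      show "g i x \<le> C * (c * P t)" if "i \<in> IU" for i
        using that c P[of t] inK by (intro gIU) auto
      show "g i x \<le> C * (2 * E t)" if "i \<in> I - IU" for i
        using that E[of t] all by (intro gI) auto
    qed (use g IU in auto)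
    also have "\<dots> = (C * (c * P t)) ^ m * (C * (2 * E t)) ^ (d - m)"
      using card_Diff_subset[OF IU(2,1)] by (simp add: m_def d_def)
    also have "\<dots> \<le> (2 * C * (c * P t)) ^ m * (C * (2 * E t)) ^ (d - m)"
      using C c P[of t] E[of t] by (intro mult_right_mono power_mono) auto
    also have "\<dots> = (2 * C) ^ (m + (d - m)) * c ^ m * (P t ^ m * E t ^ (d - m))"
      by (simp add: power_mult_distrib power_add mult_ac)
    also have "P t ^ m * E t ^ (d - m) = E t powr (- \<alpha> * m + (d - m))"
      by (rule PE)
    also have "- \<alpha> * m + (d - m) = 0" using \<open>m > 0\<close> \<open>m \<le> d\<close> by (simp add: \<alpha>_def)
    also have "(2 * C) ^ (m + (d - m)) * c ^ m * E t powr 0 = (2 * C) ^ d * c ^ m"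
      using \<open>m \<le> d\<close> E[of t] by simp
    also have "\<dots> \<le> (2 * C) ^ d * c ^ 1"
      using c C \<open>m > 0\<close> by (intro mult_left_mono power_decreasing) auto
    also have "\<dots> = 1" using c by (simp add: mult.commute)
    finally show "(\<Prod>i\<in>I. g i x) \<le> 1" .
  qed

  \<comment> \<open>A side outside \<open>K\<close> has length at least \<open>E t\<close>, except
    for the side \<open>j0\<close> of length \<open>E t / 2\<close>. The remaining power of
    \<open>E t\<close> has exponent n - k - \<alpha> k = n - d k / m, which is nonnegative by
    \<open>bnd\<close>.\<close>
  define v0 where "v0 = (2 * c) ^ k / 2"
  have "v0 > 0" using c by (simp add: v0_def)
  have vol: "ennreal v0 \<le> emeasure lborel (D t)" for t
  proof -
    have "(\<Prod>j\<in>UNIV. if j \<in> K then 2 * c * P t else E t * (if j = j0 then 1 / 2 else 1))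
        = (\<Prod>j\<in>K. 2 * c * P t) * (\<Prod>j\<in>- K. E t * (if j = j0 then 1 / 2 else 1))"
      by (simp add: prod.If_cases)
    also have "\<dots> = (2 * c * P t) ^ k * (E t ^ (n - k) * (1 / 2))"
      using j0 \<open>card K = k\<close> card_Diff_subset[of K UNIV]
      by (simp add: prod.distrib n_def Compl_eq_Diff_UNIV)
    also have "\<dots> = v0 * (P t ^ k * E t ^ (n - k))" by (simp add: v0_def power_mult_distrib)
    also have "P t ^ k * E t ^ (n - k) = E t powr (- \<alpha> * k + (n - k))"
      by (rule PE)
    finally have eq: "(\<Prod>j\<in>UNIV. if j \<in> K then 2 * c * P t else E t * (if j = j0 then 1 / 2 else 1))
        = v0 * E t powr (- \<alpha> * k + (n - k))" .
    have "real d * k \<le> real m * n" using bnd by (metis of_nat_le_iff of_nat_mult)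
    then have "- \<alpha> * k + (n - k) \<ge> 0"
      using \<open>m > 0\<close> \<open>k < n\<close> by (simp add: \<alpha>_def field_simps)
    then have "1 \<le> E t powr (- \<alpha> * k + (n - k))" using E[of t] by (intro ge_one_powr_ge_zero) auto
    then have "v0 \<le> (\<Prod>j\<in>UNIV. if j \<in> K then 2 * c * P t else E t * (if j = j0 then 1 / 2 else 1))"
      unfolding eq using \<open>v0 > 0\<close> by simp
    also have "\<dots> \<le> (\<Prod>j\<in>UNIV. (hi t - lo t) $ j)"
      using E[of t] c P[of t] by (intro prod_mono) (auto simp: hi_def lo_def)
    also have "\<dots> = (\<Prod>b\<in>Basis. (hi t - lo t) \<bullet> b)" by (rule prod_Basis_cart[where f = "\<lambda>x. x", symmetric])
    finally have "v0 \<le> (\<Prod>b\<in>Basis. (hi t - lo t) \<bullet> b)" .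
    moreover have "lo t \<bullet> b \<le> hi t \<bullet> b" if b: "b \<in> Basis" for b
    proof -
      obtain j where "b = axis j 1" using b unfolding Basis_cart_eq_range by blast
      then show ?thesis using E[of t] c P[of t] by (auto simp: inner_axis lo_def hi_def)
    qed
    ultimately show ?thesis by (simp add: D_def ennreal_leI)
  qed
  have disj: "disjoint_family D"
  proof -
    have "D s \<inter> D t = {}" if "s < t" for s t
    proof -
      have "3 / 2 * E s < E t"
      proof -
        have "2 * E s \<le> E t" using that power_increasing[of "Suc s" t "2::real"] by (simp add: E_def)
        then show ?thesis using E[of s] by simp
      qed
      then have "hi s $ j0 < lo t $ j0" using j0 by (simp add: hi_def lo_def)
      moreover have "lo t $ j0 \<le> y $ j0" "y $ j0 \<le> hi s $ j0" if "y \<in> D s \<inter> D t" for y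
        using that by (auto simp: D_def mem_box_cart)
      ultimately show ?thesis by fastforce
    qed
    then show ?thesis
      unfolding disjoint_family_on_def by (metis Int_commute nat_neq_iff)
  qed
  have "suminf (\<lambda>t :: nat. ennreal v0) = \<infinity>"
  proof (rule ccontr)
    assume "\<not> ?thesis"
    then have "summable (\<lambda>t :: nat. v0)"
      using \<open>v0 > 0\<close> by (intro summable_suminf_not_top) (simp_all add: less_imp_le)
    then show False using \<open>v0 > 0\<close> by (simp add: summable_const_iff)
  qed
  moreover have "suminf (\<lambda>t :: nat. ennreal v0) \<le> suminf (\<lambda>t. emeasure lborel (D t))"
    using vol by (intro suminf_le) auto
  moreover have "suminf (\<lambda>t. emeasure lborel (D t)) = emeasure lborel (\<Union>t. D t)"
  proof (rule suminf_emeasure)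
    show "range D \<subseteq> sets lborel" by (auto simp: D_def)
  qed (rule disj)
  ultimately have inf: "emeasure lborel (\<Union>t. D t) = \<infinity>" by (simp add: top_unique)
  obtain c' where c': "0 < c'" "\<And>A. A \<in> sets borel \<Longrightarrow> emeasure lborel ((*v) M -` A) = emeasure lborel A * c'"
    using emeasure_linear_vimage[OF matrix_vector_mul_linear injM] by blast
  have "emeasure lborel ((*v) M -` (\<Union>t. D t)) = \<infinity> * c'"
    unfolding inf[symmetric] by (intro c') (auto simp: D_def)
  also have "\<infinity> * c' = \<infinity>" using c'(1) by (simp add: ennreal_top_mult)
  finally have "emeasure lborel ((*v) M -` (\<Union>t. D t)) = \<infinity>" .
  moreover have "emeasure lborel ((*v) M -` (\<Union>t. D t)) \<le> emeasure lborel {x. (\<Prod>i\<in>I. g i x) \<le> 1}"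
    using D_sub S by (intro emeasure_mono) auto
  ultimately show ?thesis by (simp add: top_unique)
qed

section \<open>Conjugation\<close>

text \<open>Take a linear map that kills \<open>X\<close> and fixes \<open>v\<close>. The row of its
  matrix at a nonzero coordinate of \<open>v\<close> is the required \<open>z\<close>.\<close>

lemma exists_annihilator1:
  fixes v :: "complex ^ 'n::finite"
  assumes X: "vec.subspace X" and v: "v \<notin> X"
  obtains z where "\<And>u. u \<in> X \<Longrightarrow> form_eval u z = 0" "form_eval v z \<noteq> 0"
proof -
  obtain B where B: "B \<subseteq> X" "vec.independent B" "X \<subseteq> vec.span B"
    by (rule vec.maximal_independent_subset)
  have "vec.span B = X" using B X by (simp add: vec.span_subspace)
  then have "vec.independent (insert v B)" using v B by (simp add: vec.independent_insertI)
  then obtain g where g: "Vector_Spaces.linear (*s) (*s) g"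
      "\<forall>x\<in>insert v B. g x = (if x = v then v else 0)"
    using vec.linear_independent_extend[of "insert v B" "\<lambda>x. if x = v then v else 0"] by blast
  have "v \<noteq> 0" using v X vec.subspace_0 by blast
  then obtain j where j: "v $ j \<noteq> 0" by (auto simp: vec_eq_iff)
  have eval: "form_eval u (matrix g $ j) = g u $ j" for u
  proof -
    have "g u $ j = (matrix g *v u) $ j" using matrix_works[OF g(1)] by simp
    then show ?thesis by (simp add: form_eval_def matrix_vector_mult_def mult.commute)
  qed
  show ?thesis
  proof (rule that)
    show "form_eval v (matrix g $ j) \<noteq> 0" using g j by (simp add: eval)
    fix u assume "u \<in> X"
    have "v \<notin> B" using v B by blast
    then have "g b = 0" if "b \<in> B" for b using g(2) that by auto
    moreover have "u \<in> vec.span B" using \<open>u \<in> X\<close> \<open>vec.span B = X\<close> by simp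
    ultimately have "g u = 0" by (rule vec.linear_eq_0_on_span[OF g(1)])
    then show "form_eval u (matrix g $ j) = 0" by (simp add: eval)
  qed
qed

text \<open>A complex vector space is not a finite union of proper subspaces. Inductively, on the
  line \<open>z + t *s y\<close> each index excludes at most one \<open>t\<close>.\<close>

lemma exists_annihilator:
  fixes v :: "'i \<Rightarrow> complex ^ 'n::finite"
  assumes X: "vec.subspace X" and "finite I" and "\<And>i. i \<in> I \<Longrightarrow> v i \<notin> X"
  shows "\<exists>z. (\<forall>u\<in>X. form_eval u z = 0) \<and> (\<forall>i\<in>I. form_eval (v i) z \<noteq> 0)"
  using assms(2,3)
proof (induction I rule: finite_induct)
  case empty
  show ?case by (rule exI[of _ 0]) (simp add: form_eval_def)
next
  case (insert i I)
  then obtain z where z: "\<forall>u\<in>X. form_eval u z = 0" "\<forall>i\<in>I. form_eval (v i) z \<noteq> 0" by auto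
  obtain y where y: "\<And>u. u \<in> X \<Longrightarrow> form_eval u y = 0" "form_eval (v i) y \<noteq> 0"
    using exists_annihilator1[OF X, of "v i"] insert.prems by blast
  define bad where "bad k = {t. form_eval (v k) z + t * form_eval (v k) y = 0}" for k
  have "finite (bad k)" if "k \<in> insert i I" for k
  proof (cases "form_eval (v k) y = 0")
    case True
    then have "bad k = {}" using that z y by (auto simp: bad_def)
    then show ?thesis by simp
  next
    case False
    have "bad k \<subseteq> {- form_eval (v k) z / form_eval (v k) y}"
    proof
      fix t assume "t \<in> bad k"
      then have "t * form_eval (v k) y = - form_eval (v k) z" by (simp add: bad_def add_eq_0_iff)
      then have "t = - form_eval (v k) z / form_eval (v k) y"
        using False by (subst nonzero_eq_divide_eq) auto
      then show "t \<in> {- form_eval (v k) z / form_eval (v k) y}" by simp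
    qed
    then show ?thesis by (rule finite_subset) simp
  qed
  then have "finite (\<Union>k\<in>insert i I. bad k)" using insert.hyps by blast
  then obtain t where t: "t \<notin> (\<Union>k\<in>insert i I. bad k)"
    using ex_new_if_finite[OF infinite_UNIV_char_0] by blast
  have "form_eval (v k) (z + t *s y) \<noteq> 0" if "k \<in> insert i I" for k
    using t that by (auto simp: bad_def form_eval_add_right form_eval_scale_right)
  moreover have "form_eval u (z + t *s y) = 0" if "u \<in> X" for u
    using that z y by (simp add: form_eval_add_right form_eval_scale_right)
  ultimately show ?case by blast
qed

text \<open>Since all \<open>b i\<close> are nonzero, the first product vanishes at t = 0 exactly to
  the order given by the number of zero \<open>a i\<close>. The second vanishes at least to the
  order given by the number of zero \<open>a' i\<close>, and equal norms force equal orders.\<close>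

lemma card_zeros_le:
  fixes a b a' b' :: "'i \<Rightarrow> complex"
  assumes fin: "finite I" and b: "\<And>i. i \<in> I \<Longrightarrow> b i \<noteq> 0"
    and eq: "\<And>t :: real. norm (\<Prod>i\<in>I. a i + of_real t * b i) = norm (\<Prod>i\<in>I. a' i + of_real t * b' i)"
  shows "card {i \<in> I. a' i = 0} \<le> card {i \<in> I. a i = 0}"
proof (rule ccontr)
  define m m' where "m = card {i \<in> I. a i = 0}" and "m' = card {i \<in> I. a' i = 0}"
  assume "\<not> ?thesis"
  then have lt: "m < m'" by (simp add: m_def m'_def)
  have split: "(\<Prod>i\<in>I. a i + of_real t * b i) = of_real t ^ card {i \<in> I. a i = 0} *
      (\<Prod>i\<in>I. if a i = 0 then b i else a i + of_real t * b i)" for t :: real and a b :: "'i \<Rightarrow> complex"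
  proof -
    have "(\<Prod>i\<in>I. a i + of_real t * b i) =
        (\<Prod>i\<in>I. (if a i = 0 then of_real t else 1) * (if a i = 0 then b i else a i + of_real t * b i))"
      by (intro prod.cong) auto
    also have "\<dots> = (\<Prod>i\<in>I. if a i = 0 then of_real t else 1) *
        (\<Prod>i\<in>I. if a i = 0 then b i else a i + of_real t * b i)" by (rule prod.distrib)
    also have "(\<Prod>i\<in>I. if a i = 0 then complex_of_real t else 1) = of_real t ^ card {i \<in> I. a i = 0}"
      using fin by (simp add: prod.If_cases Int_def)
    finally show ?thesis .
  qed
  define r where "r t = (\<Prod>i\<in>I. if a i = 0 then b i else a i + of_real t * b i)" for t :: real
  define s where "s t = (\<Prod>i\<in>I. if a' i = 0 then b' i else a' i + of_real t * b' i)" for t :: real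
  have "isCont (\<lambda>t. if a i = 0 then b i else a i + of_real t * b i) 0"
    for i and a b :: "'i \<Rightarrow> complex"
    by (cases "a i = 0") (auto intro!: continuous_intros)
  then have cont: "isCont r 0" "isCont s 0"
    unfolding r_def s_def by (auto intro!: continuous_intros)
  \<comment> \<open>The common power of \<open>t\<close> cancels only for
    \<open>t \<noteq> 0\<close>; continuity recovers the value at 0, where the right side vanishes
    but every factor of \<open>r 0\<close> is nonzero.\<close>
  have "norm (r t) = norm (of_real t ^ (m' - m) * s t)" if "t \<noteq> 0" for t
  proof -
    have "norm (of_real t ^ m * r t) = norm (of_real t ^ m' * s t)"
      using eq[of t] unfolding split r_def s_def m_def m'_def .
    also have "of_real t ^ m' = (of_real t ^ m * of_real t ^ (m' - m) :: complex)"
      using lt by (simp flip: power_add)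
    finally show ?thesis using that by (simp add: norm_mult norm_power)
  qed
  then have ev: "eventually (\<lambda>t. norm (r t) = norm (of_real t ^ (m' - m) * s t)) (at 0)"
    by (auto simp: eventually_at_filter)
  have "((\<lambda>t. norm (of_real t ^ (m' - m) * s t)) \<longlongrightarrow> norm (of_real 0 ^ (m' - m) * s 0)) (at 0)"
    using cont by (intro tendsto_intros) (auto simp: isCont_def)
  moreover have "((\<lambda>t. norm (r t)) \<longlongrightarrow> norm (r 0)) (at 0)"
    using cont by (intro tendsto_intros) (auto simp: isCont_def)
  then have "((\<lambda>t. norm (of_real t ^ (m' - m) * s t)) \<longlongrightarrow> norm (r 0)) (at 0)"
    using tendsto_cong[OF ev] by blast
  ultimately have "norm (r 0) = norm (of_real 0 ^ (m' - m) * s 0)"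
    using tendsto_unique[OF trivial_limit_at] by blast
  then have "r 0 = 0" using lt by (simp add: power_0_left)
  then show False using fin b by (auto simp: r_def split: if_splits)
qed

section \<open>Subspaces stable under conjugation\<close>

lemma cnj_vec_add [simp]: "cnj_vec (u + v) = cnj_vec u + cnj_vec v"
  and cnj_vec_scale [simp]: "cnj_vec (c *s v) = cnj c *s cnj_vec v"
  and cnj_vec_zero [simp]: "cnj_vec 0 = 0"
  by (simp_all add: cnj_vec_def vec_eq_iff)

lemma cnj_vec_eq_0_iff [simp]: "cnj_vec v = 0 \<longleftrightarrow> v = 0"
  by (simp add: cnj_vec_def vec_eq_iff)

lemma cnj_vec_image_iff: "v \<in> cnj_vec ` X \<longleftrightarrow> cnj_vec v \<in> X"
  by (metis cnj_vec_cnj_vec image_eqI imageE)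

lemma subspace_cnj_vec_image: "vec.subspace X \<Longrightarrow> vec.subspace (cnj_vec ` X)"
  unfolding vec.subspace_def cnj_vec_image_iff by simp

text \<open>An inclusion is enough: conjugation is an involution, so \<open>X\<close> then equals
  its conjugate.\<close>

definition cnj_invariant :: "(complex ^ 'n) set \<Rightarrow> bool" where
  "cnj_invariant X \<longleftrightarrow> (\<forall>v\<in>X. cnj_vec v \<in> X)"

lemma cnj_invariant_span: "(\<And>v. v \<in> S \<Longrightarrow> cnj_vec v \<in> vec.span S) \<Longrightarrow> cnj_invariant (vec.span S)"
proof -
  assume *: "\<And>v. v \<in> S \<Longrightarrow> cnj_vec v \<in> vec.span S"
  have "S \<subseteq> cnj_vec ` vec.span S" using * by (auto simp: cnj_vec_image_iff)
  then have "vec.span S \<subseteq> cnj_vec ` vec.span S"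
    by (intro vec.span_minimal subspace_cnj_vec_image) auto
  then show ?thesis by (auto simp: cnj_invariant_def cnj_vec_image_iff)
qed

lemma cnj_invariant_span_insert:
  assumes "cnj_invariant (vec.span S)" "cnj_vec v \<in> vec.span (insert v S)"
  shows "cnj_invariant (vec.span (insert v S))"
proof (rule cnj_invariant_span)
  fix u assume "u \<in> insert v S"
  moreover have "vec.span S \<subseteq> vec.span (insert v S)" by (intro vec.span_mono) auto
  ultimately show "cnj_vec u \<in> vec.span (insert v S)"
    using assms by (auto simp: cnj_invariant_def dest: vec.span_base)
qed

text \<open>The factor \<open>c\<close> is present because a factor of \<open>F\<close> conjugate to
  \<open>L i\<close> is determined only up to a scalar.\<close>

lemma cnj_invariant_span_insert2:
  assumes S: "cnj_invariant (vec.span S)" and "c \<noteq> 0"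
  shows "cnj_invariant (vec.span (insert (c *s cnj_vec v) (insert v S)))"
proof (rule cnj_invariant_span)
  let ?T = "insert (c *s cnj_vec v) (insert v S)"
  fix u assume "u \<in> ?T"
  moreover have "vec.span S \<subseteq> vec.span ?T" by (intro vec.span_mono) auto
  then have "cnj_vec u \<in> vec.span ?T" if "u \<in> S"
    using S that by (auto simp: cnj_invariant_def dest: vec.span_base)
  moreover have "cnj_vec v \<in> vec.span ?T"
  proof -
    have "inverse c *s (c *s cnj_vec v) \<in> vec.span ?T"
      by (intro vec.span_scale vec.span_base) simp
    then show ?thesis using \<open>c \<noteq> 0\<close> by simp
  qed
  moreover have "cnj_vec (c *s cnj_vec v) \<in> vec.span ?T"
    by (simp add: vec.span_scale vec.span_base)
  ultimately show "cnj_vec u \<in> vec.span ?T" by auto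
qed

section \<open>Complexification of real subspaces\<close>

text \<open>For a subspace \<open>U\<close> this is U + iU. Membership of \<open>L i\<close> is
  literally the condition counted in the volume criterion.\<close>

definition complexification :: "(real ^ 'n) set \<Rightarrow> (complex ^ 'n) set" where
  "complexification U = {v. Re_vec v \<in> U \<and> Im_vec v \<in> U}"

lemma Re_vec_add: "Re_vec (u + v) = Re_vec u + Re_vec v"
  and Im_vec_add: "Im_vec (u + v) = Im_vec u + Im_vec v"
  and Re_vec_scale: "Re_vec (c *s v) = Re c *\<^sub>R Re_vec v - Im c *\<^sub>R Im_vec v"
  and Im_vec_scale: "Im_vec (c *s v) = Re c *\<^sub>R Im_vec v + Im c *\<^sub>R Re_vec v"
  and Re_vec_zero [simp]: "Re_vec 0 = 0" and Im_vec_zero [simp]: "Im_vec 0 = 0"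
  and Re_vec_cnj [simp]: "Re_vec (cnj_vec v) = Re_vec v"
  and Im_vec_cnj [simp]: "Im_vec (cnj_vec v) = - Im_vec v"
  and Re_vec_complex_vec [simp]: "Re_vec (complex_vec w) = w"
  and Im_vec_complex_vec [simp]: "Im_vec (complex_vec w) = 0"
  by (simp_all add: Re_vec_def Im_vec_def cnj_vec_def complex_vec_def vec_eq_iff)

lemma vec_eq_iff_Re_Im: "u = v \<longleftrightarrow> Re_vec u = Re_vec v \<and> Im_vec u = Im_vec v"
  by (auto simp: Re_vec_def Im_vec_def vec_eq_iff complex_eq_iff)

lemma complex_vec_Re_Im: "v = complex_vec (Re_vec v) + \<i> *s complex_vec (Im_vec v)"
  by (simp add: vec_eq_iff_Re_Im Re_vec_add Im_vec_add Re_vec_scale Im_vec_scale)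

lemma Re_vec_sum: "Re_vec (\<Sum>k\<in>A. f k) = (\<Sum>k\<in>A. Re_vec (f k))"
  and Im_vec_sum: "Im_vec (\<Sum>k\<in>A. f k) = (\<Sum>k\<in>A. Im_vec (f k))"
  by (induction A rule: infinite_finite_induct) (auto simp: Re_vec_add Im_vec_add)

lemma subspace_complexification: "subspace U \<Longrightarrow> vec.subspace (complexification U)"
  by (auto simp: vec.subspace_def complexification_def Re_vec_add Im_vec_add Re_vec_scale
      Im_vec_scale subspace_0 subspace_add subspace_diff subspace_scale)

lemma cnj_invariant_complexification: "subspace U \<Longrightarrow> cnj_invariant (complexification U)"
  by (auto simp: cnj_invariant_def complexification_def subspace_neg)

text \<open>A real basis of \<open>U\<close> is a complex basis of its complexification: a complex
  relation splits into two real ones, and a vector splits into its real and imaginary parts.\<close>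

lemma dim_complexification:
  fixes U :: "(real ^ 'n) set"
  assumes U: "subspace U"
  shows "vec.dim (complexification U) = dim U"
proof -
  obtain B where B: "B \<subseteq> U" "independent B" "U \<subseteq> span B" "card B = dim U"
    by (rule basis_exists[of U])
  have finB: "finite B" using B independent_imp_finite by blast
  have inj: "inj_on complex_vec B" by (metis Re_vec_complex_vec inj_onI)
  have "vec.independent (complex_vec ` B)"
  proof (rule vec.independent_if_scalars_zero)
    fix c x assume sum: "(\<Sum>x\<in>complex_vec ` B. c x *s x) = 0" and x: "x \<in> complex_vec ` B"
    have sum': "(\<Sum>b\<in>B. c (complex_vec b) *s complex_vec b) = 0"
      using sum by (simp add: sum.reindex[OF inj])
    have "(\<Sum>b\<in>B. Re (c (complex_vec b)) *\<^sub>R b) = 0" "(\<Sum>b\<in>B. Im (c (complex_vec b)) *\<^sub>R b) = 0"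
      using arg_cong[OF sum', of Re_vec] arg_cong[OF sum', of Im_vec]
      by (simp_all add: Re_vec_sum Im_vec_sum Re_vec_scale Im_vec_scale)
    then have "Re (c (complex_vec b)) = 0" "Im (c (complex_vec b)) = 0" if "b \<in> B" for b
      using independentD[OF B(2) finB subset_refl, of "\<lambda>b. Re (c (complex_vec b))" b]
        independentD[OF B(2) finB subset_refl, of "\<lambda>b. Im (c (complex_vec b))" b] that by auto
    then show "c x = 0" using x by (auto simp: complex_eq_iff)
  qed (simp add: finB)
  moreover have "complexification U \<subseteq> vec.span (complex_vec ` B)"
  proof
    have real: "complex_vec u \<in> vec.span (complex_vec ` B)" if "u \<in> span B" for u
      using that
    proof (induction rule: span_induct_alt)
      case base
      then show ?case by (simp add: complex_vec_def vec.span_zero flip: zero_vec_def)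
    next
      case (step c x y)
      have "complex_vec (c *\<^sub>R x + y) = of_real c *s complex_vec x + complex_vec y"
        by (simp add: complex_vec_def vec_eq_iff)
      then show ?case using step by (simp add: vec.span_add vec.span_scale vec.span_base)
    qed
    fix v assume "v \<in> complexification U"
    then have "complex_vec (Re_vec v) + \<i> *s complex_vec (Im_vec v) \<in> vec.span (complex_vec ` B)"
      using B real by (intro vec.span_add vec.span_scale) (auto simp: complexification_def)
    then show "v \<in> vec.span (complex_vec ` B)" using complex_vec_Re_Im[of v] by simp
  qed
  moreover have "complex_vec ` B \<subseteq> complexification U"
    using B U by (auto simp: complexification_def subspace_0)
  ultimately have "vec.dim (complexification U) = card (complex_vec ` B)"
    using vec.dim_unique by blast
  then show ?thesis using card_image[OF inj] B by simp
qed

text \<open>\<open>U\<close> consists of the real points of \<open>X\<close>. The real and imaginary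
  parts of \<open>v\<close> are combinations of \<open>v\<close> and its conjugate, so they stay in
  \<open>X\<close>.\<close>

lemma cnj_invariant_imp_complexification:
  assumes X: "vec.subspace X" and inv: "cnj_invariant X"
  obtains U where "subspace U" "X = complexification U"
proof
  let ?U = "{u. complex_vec u \<in> X}"
  have [simp]: "complex_vec (u + v) = complex_vec u + complex_vec v"
    "complex_vec (c *\<^sub>R u) = of_real c *s complex_vec u" "complex_vec 0 = 0" for u v :: "real ^ 'n" and c
    by (simp_all add: complex_vec_def vec_eq_iff)
  show "subspace ?U"
    using X by (auto intro!: subspaceI simp: vec.subspace_0 vec.subspace_add vec.subspace_scale)
  show "X = complexification ?U"
  proof (intro equalityI subsetI)
    fix v assume v: "v \<in> X"
    then have "cnj_vec v \<in> X" using inv by (simp add: cnj_invariant_def)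
    have "complex_vec (Re_vec v) = (1 / 2) *s (v + cnj_vec v)"
      "complex_vec (Im_vec v) = (- \<i> / 2) *s (v + (- 1) *s cnj_vec v)"
      by (simp_all add: complex_vec_def Re_vec_def Im_vec_def cnj_vec_def vec_eq_iff complex_eq_iff)
    moreover have "(1 / 2) *s (v + cnj_vec v) \<in> X" "(- \<i> / 2) *s (v + (- 1) *s cnj_vec v) \<in> X"
      by (intro vec.subspace_scale[OF X] vec.subspace_add[OF X] v \<open>cnj_vec v \<in> X\<close>)+
    ultimately show "v \<in> complexification ?U" by (simp add: complexification_def)
  next
    fix v assume "v \<in> complexification ?U"
    then have "complex_vec (Re_vec v) + \<i> *s complex_vec (Im_vec v) \<in> X"
      using X by (intro vec.subspace_add vec.subspace_scale) (auto simp: complexification_def)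
    then show "v \<in> X" using complex_vec_Re_Im[of v] by simp
  qed
qed

section \<open>Conjugation-symmetric families of linear forms\<close>

lemma vec_dim_le_card: "vec.dim (S :: ('a::field ^ 'n::finite) set) \<le> CARD('n)"
  by (metis vec.dim_subset subset_UNIV vec_dim_card)

lemma vec_span_eq_UNIV_iff: "vec.span S = UNIV \<longleftrightarrow> vec.dim (S :: ('a::field ^ 'n::finite) set) = CARD('n)"
  using vec.dim_eq_full[of S] vec_dim_card[where 'n = 'n and 'a = 'a] by (simp add: vec.dimension_def)

text \<open>The combinatorics of the factors uses \<open>F\<close> only through the compatibility of
  its values with conjugation; no unique factorization of polynomials is invoked.\<close>

locale cnj_symmetric_forms =
  fixes d :: nat and L :: "nat \<Rightarrow> complex ^ 'n::finite"
  assumes nonzero: "i \<in> {1..d} \<Longrightarrow> L i \<noteq> 0"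
    and eval_cnj: "(\<Prod>i=1..d. form_eval (L i) (cnj_vec z)) = cnj (\<Prod>i=1..d. form_eval (L i) z)"
    and d_pos: "d \<ge> 1"
begin

section \<open>Counting the forms in a subspace\<close>

definition num :: "(complex ^ 'n) set \<Rightarrow> nat" where
  "num X = card {i \<in> {1..d}. L i \<in> X}"

lemma num_mono: "X \<subseteq> Y \<Longrightarrow> num X \<le> num Y"
  unfolding num_def by (intro card_mono) auto

lemma num_UNIV [simp]: "num UNIV = d"
proof -
  have "{i \<in> {1..d}. L i \<in> UNIV} = {1..d}" by auto
  then show ?thesis unfolding num_def by simp
qed

lemma num_le_d: "num X \<le> d"
  using num_mono[of X UNIV] by simp

lemma num_zero [simp]: "num {0} = 0"
  using nonzero by (auto simp: num_def card_eq_0_iff)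

lemma exists_common_nonzero: "\<exists>w. \<forall>i\<in>{1..d}. form_eval (L i) w \<noteq> 0"
proof -
  have "\<exists>w. (\<forall>u\<in>{0}. form_eval u w = 0) \<and> (\<forall>i\<in>{1..d}. form_eval (L i) w \<noteq> 0)"
    by (rule exists_annihilator) (use nonzero in \<open>auto simp: vec.subspace_single_0\<close>)
  then show ?thesis by blast
qed

text \<open>
  \<open>num X\<close> is the order of vanishing at \<open>t = 0\<close> of \<open>F(z + t w)\<close> for generic \<open>w\<close> and a generic \<open>z\<close> in the
  annihilator of \<open>X\<close>; conjugating \<open>z\<close> and \<open>w\<close> conjugates the value of \<open>F\<close>.
\<close>
lemma num_cnj_le:
  assumes X: "vec.subspace X"
  shows "num (cnj_vec ` X) \<le> num X"
proof -
  have "\<exists>z. (\<forall>u\<in>X. form_eval u z = 0) \<and> (\<forall>i\<in>{i \<in> {1..d}. L i \<notin> X}. form_eval (L i) z \<noteq> 0)"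
    by (rule exists_annihilator[OF X]) auto
  then obtain z where z: "\<forall>u\<in>X. form_eval u z = 0" "\<forall>i\<in>{i \<in> {1..d}. L i \<notin> X}. form_eval (L i) z \<noteq> 0"
    by blast
  obtain w where w: "\<forall>i\<in>{1..d}. form_eval (L i) w \<noteq> 0"
    using exists_common_nonzero by blast
  have "num X = card {i \<in> {1..d}. form_eval (L i) z = 0}"
    unfolding num_def using z by (intro arg_cong[of _ _ card]) auto
  \<comment> \<open>Only an inequality is shown here, as \<open>cnj_vec z\<close> might annihilate
    further forms. The reverse comparison in \<open>num_cnj\<close> comes from applying the result
    to the conjugate subspace.\<close>
  moreover have "num (cnj_vec ` X) \<le> card {i \<in> {1..d}. form_eval (L i) (cnj_vec z) = 0}"
  proof -
    have "form_eval v (cnj_vec z) = 0" if "v \<in> cnj_vec ` X" for v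
      using that z by (auto simp: form_eval_cnj)
    then show ?thesis unfolding num_def by (intro card_mono) auto
  qed
  moreover have "card {i \<in> {1..d}. form_eval (L i) (cnj_vec z) = 0} \<le> card {i \<in> {1..d}. form_eval (L i) z = 0}"
  proof (rule card_zeros_le)
    show "form_eval (L i) w \<noteq> 0" if "i \<in> {1..d}" for i using w that by blast
    fix t :: real
    have "cnj_vec (z + of_real t *s w) = cnj_vec z + of_real t *s cnj_vec w" by simp
    then have "(\<Prod>i=1..d. form_eval (L i) (cnj_vec z) + of_real t * form_eval (L i) (cnj_vec w))
        = cnj (\<Prod>i=1..d. form_eval (L i) z + of_real t * form_eval (L i) w)"
      using eval_cnj[of "z + of_real t *s w"]
      by (simp only: form_eval_add_right form_eval_scale_right)
    then show "norm (\<Prod>i=1..d. form_eval (L i) z + of_real t * form_eval (L i) w) =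
        norm (\<Prod>i=1..d. form_eval (L i) (cnj_vec z) + of_real t * form_eval (L i) (cnj_vec w))"
      by (simp only: complex_mod_cnj)
  qed simp
  ultimately show ?thesis by simp
qed

lemma num_cnj:
  assumes "vec.subspace X"
  shows "num (cnj_vec ` X) = num X"
proof (rule antisym)
  have "cnj_vec ` cnj_vec ` X = X" by (simp add: image_comp comp_def)
  then show "num X \<le> num (cnj_vec ` X)"
    using num_cnj_le[OF subspace_cnj_vec_image[OF assms]] by simp
qed (rule num_cnj_le[OF assms])

text \<open>The line through \<open>L i\<close> contains a form, so by \<open>num_cnj\<close> the
  conjugate line contains one as well.\<close>

lemma exists_cnj_multiple:
  assumes i: "i \<in> {1..d}"
  obtains i' c where "i' \<in> {1..d}" "c \<noteq> 0" "L i' = c *s cnj_vec (L i)"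
proof -
  let ?X = "vec.span {L i}"
  have "i \<in> {i \<in> {1..d}. L i \<in> ?X}" using i by (simp add: vec.span_base)
  then have "num ?X > 0" unfolding num_def by (subst card_gt_0_iff) auto
  then have "num (cnj_vec ` ?X) > 0" by (simp add: num_cnj)
  then obtain i' where i': "i' \<in> {1..d}" "L i' \<in> cnj_vec ` ?X"
    unfolding num_def by (auto simp: card_gt_0_iff)
  then obtain k where "L i' = cnj_vec (k *s L i)"
    unfolding vec.span_singleton by blast
  then have "L i' = cnj k *s cnj_vec (L i)" by simp
  moreover have "cnj k \<noteq> 0" using calculation nonzero[OF i'(1)] by auto
  ultimately show ?thesis using that i' by blast
qed

lemma cnj_invariant_span_forms:
  assumes "cnj_invariant X" "vec.subspace X"
  shows "cnj_invariant (vec.span {L i | i. i \<in> {1..d} \<and> L i \<in> X})"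
proof (rule cnj_invariant_span)
  fix v assume "v \<in> {L i | i. i \<in> {1..d} \<and> L i \<in> X}"
  then obtain i where i: "i \<in> {1..d}" "L i \<in> X" "v = L i" by blast
  obtain i' c where i': "i' \<in> {1..d}" "c \<noteq> 0" "L i' = c *s cnj_vec (L i)"
    by (rule exists_cnj_multiple[OF i(1)])
  have "L i' \<in> X" using i i' assms by (simp add: cnj_invariant_def vec.subspace_scale)
  then have "inverse c *s L i' \<in> vec.span {L i | i. i \<in> {1..d} \<and> L i \<in> X}"
    using i' by (intro vec.span_scale vec.span_base) blast
  then show "cnj_vec v \<in> vec.span {L i | i. i \<in> {1..d} \<and> L i \<in> X}" using i i' by simp
qed

section \<open>Chains of spans\<close>

text \<open>The conditions defining J(F), for lists of arbitrary length, so that tuples can be built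
  by appending.\<close>

definition good :: "nat list \<Rightarrow> bool" where
  "good is \<longleftrightarrow> set is \<subseteq> {1..d} \<and> distinct (map L is) \<and> vec.independent (set (map L is)) \<and>
     (\<forall>j\<in>{1..<length is}. (\<exists>c. L (is ! j) = c *s cnj_vec (L (is ! (j - 1)))) \<or>
       cnj_vec (L (is ! (j - 1))) \<in> span_first L is j)"

lemma J_tuples_iff: "is \<in> J_tuples d L \<longleftrightarrow> length is = CARD('n) \<and> good is"
  by (auto simp: J_tuples_def I_tuples_def good_def)

lemma good_length: "good is \<Longrightarrow> length is = card (set (map L is))"
  by (metis good_def distinct_card length_map)

lemma dim_span_good: "good is \<Longrightarrow> vec.dim (vec.span (set (map L is))) = length is"
  using good_length good_def vec.dim_span_eq_card_independent by metis

lemma dim_span_first: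
  assumes "good is" "j \<le> length is"
  shows "vec.dim (span_first L is j) = j"
proof -
  have "set (map L (take j is)) \<subseteq> set (map L is)" by (auto dest: in_set_takeD)
  then have "vec.independent (set (map L (take j is)))"
    using assms vec.independent_mono by (auto simp: good_def)
  moreover have "distinct (map L (take j is))"
    using assms distinct_take[of "map L is" j] by (simp add: good_def take_map)
  then have "card (set (map L (take j is))) = j"
    using assms by (metis distinct_card length_map length_take min.absorb2)
  ultimately show ?thesis
    unfolding span_first_def using vec.dim_span_eq_card_independent by metis
qed

lemma span_first_Suc:
  assumes "j < length is"
  shows "span_first L is (Suc j) = vec.span (insert (L (is ! j)) (set (map L (take j is))))"
  using assms by (simp add: span_first_def take_Suc_conv_app_nth)

lemma span_first_mono: "i \<le> j \<Longrightarrow> span_first L is i \<subseteq> span_first L is j"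
  unfolding span_first_def by (intro vec.span_mono) (auto dest: set_take_subset_set_take[THEN subsetD])

text \<open>From a stable stage, either the conjugate of the new vector is already in the next span,
  which is then stable, or the chain condition makes the following vector proportional to that
  conjugate and the stage after is stable. Thus two consecutive stages are never both
  unstable.\<close>

lemma span_first_cases:
  assumes g: "good is" and j: "j < length is"
  shows "cnj_invariant (span_first L is j) \<or>
    (j \<ge> 1 \<and> cnj_invariant (span_first L is (j - 1)) \<and> cnj_invariant (span_first L is (Suc j)) \<and>
     cnj_vec (L (is ! (j - 1))) \<notin> span_first L is j)"
  using j
proof (induction j)
  case 0
  then show ?case by (auto simp: span_first_def cnj_invariant_def)
next
  case (Suc j)
  let ?S = "\<lambda>k. set (map L (take k is))"
  have Sj: "span_first L is j = vec.span (?S j)" by (simp add: span_first_def)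
  show ?case
  proof (cases "cnj_invariant (span_first L is j)")
    case inv: True
    show ?thesis
    proof (cases "cnj_vec (L (is ! j)) \<in> span_first L is (Suc j)")
      case True
      then show ?thesis
        using inv Suc.prems cnj_invariant_span_insert[of "?S j" "L (is ! j)"]
        by (simp add: span_first_Suc Sj)
    next
      case False
      then obtain c where c: "L (is ! Suc j) = c *s cnj_vec (L (is ! j))"
        using g Suc.prems unfolding good_def by (metis atLeastLessThan_iff diff_Suc_1 le_add1 plus_1_eq_Suc)
      have "L (is ! Suc j) \<noteq> 0"
        using nonzero g Suc.prems nth_mem by (meson good_def subsetD)
      then have "c \<noteq> 0" using c by auto
      then have "cnj_invariant (vec.span (insert (L (is ! Suc j)) (insert (L (is ! j)) (?S j))))"
        unfolding c using inv by (intro cnj_invariant_span_insert2) (simp_all add: Sj)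
      moreover have "?S (Suc j) = insert (L (is ! j)) (?S j)"
        using Suc.prems by (simp add: take_Suc_conv_app_nth)
      ultimately have "cnj_invariant (span_first L is (Suc (Suc j)))"
        using Suc.prems by (simp add: span_first_Suc del: set_map)
      then show ?thesis using inv False by simp
    qed
  next
    case False
    then show ?thesis using Suc by auto
  qed
qed

lemma two_num_span_first:
  assumes g: "good is" and j: "j < length is" "j \<ge> 1"
    and inv: "cnj_invariant (span_first L is (j - 1))" "cnj_invariant (span_first L is (Suc j))"
    and notin: "cnj_vec (L (is ! (j - 1))) \<notin> span_first L is j"
  shows "2 * num (span_first L is j) \<le> num (span_first L is (j - 1)) + num (span_first L is (Suc j))"
    and "span_first L is j \<inter> cnj_vec ` span_first L is j \<subseteq> span_first L is (j - 1)"
proof -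
  let ?S = "span_first L is"
  let ?v = "L (is ! (j - 1))"
  have sub: "vec.subspace (?S j)" by (simp add: span_first_def)
  have cap: "?S j \<inter> cnj_vec ` ?S j \<subseteq> ?S (j - 1)"
  proof
    fix u assume "u \<in> ?S j \<inter> cnj_vec ` ?S j"
    then have u: "u \<in> ?S j" "cnj_vec u \<in> ?S j" by (auto simp: cnj_vec_image_iff)
    have "?S j = vec.span (insert ?v (set (map L (take (j - 1) is))))"
      using span_first_Suc[of "j - 1" "is"] j by simp
    \<comment> \<open>Modulo the stable stage \<open>j - 1\<close>, \<open>u\<close> is
      \<open>k\<close> times the last vector. Conjugating puts \<open>cnj k *s cnj_vec ?v\<close> in
      stage \<open>j\<close>, which by \<open>notin\<close> forces \<open>k = 0\<close>.\<close>
    then obtain k where k: "u - k *s ?v \<in> ?S (j - 1)"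
      using u by (auto simp: vec.span_insert span_first_def)
    have "cnj_vec (u - k *s ?v) \<in> ?S j"
      using k inv span_first_mono[of "j - 1" j "is"] by (auto simp: cnj_invariant_def)
    then have "cnj_vec u - cnj_vec (u - k *s ?v) \<in> ?S j"
      using u sub by (intro vec.subspace_diff) auto
    also have "cnj_vec u - cnj_vec (u - k *s ?v) = cnj k *s cnj_vec ?v"
      by (simp add: cnj_vec_def vec_eq_iff)
    finally have *: "cnj k *s cnj_vec ?v \<in> ?S j" .
    have "k = 0"
    proof (rule ccontr)
      assume "k \<noteq> 0"
      then have "inverse (cnj k) *s (cnj k *s cnj_vec ?v) = cnj_vec ?v" by simp
      then show False using vec.subspace_scale[OF sub *, of "inverse (cnj k)"] notin by simp
    qed
    then show "u \<in> ?S (j - 1)" using k by simp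
  qed
  then show "?S j \<inter> cnj_vec ` ?S j \<subseteq> ?S (j - 1)" .
  let ?A = "{i \<in> {1..d}. L i \<in> ?S j}" and ?B = "{i \<in> {1..d}. L i \<in> cnj_vec ` ?S j}"
  have "2 * num (?S j) = card ?A + card ?B"
    using num_cnj[OF sub] by (simp add: num_def)
  also have "\<dots> = card (?A \<union> ?B) + card (?A \<inter> ?B)" by (rule card_Un_Int) auto
  also have "card (?A \<union> ?B) \<le> num (?S (Suc j))"
    unfolding num_def using span_first_mono[of j "Suc j" "is"] inv
    by (intro card_mono) (auto simp: cnj_invariant_def)
  also have "card (?A \<inter> ?B) \<le> num (?S (j - 1))"
    unfolding num_def using cap by (intro card_mono) auto
  finally show "2 * num (?S j) \<le> num (?S (j - 1)) + num (?S (Suc j))" by simp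
qed

lemma good_Nil [simp]: "good []"
  by (simp add: good_def vec.independent_empty)

lemma good_snoc:
  assumes g: "good is" and i: "i \<in> {1..d}" "L i \<notin> vec.span (set (map L is))"
    and chain: "is \<noteq> [] \<Longrightarrow> (\<exists>c. L i = c *s cnj_vec (L (last is))) \<or>
      cnj_vec (L (last is)) \<in> vec.span (set (map L is))"
  shows "good (is @ [i])"
proof -
  have "L i \<notin> set (map L is)" using i vec.span_base by blast
  moreover have "vec.independent (insert (L i) (set (map L is)))"
    using g i by (intro vec.independent_insertI) (simp_all add: good_def)
  moreover have "(\<exists>c. L ((is @ [i]) ! j) = c *s cnj_vec (L ((is @ [i]) ! (j - 1)))) \<or>
       cnj_vec (L ((is @ [i]) ! (j - 1))) \<in> span_first L (is @ [i]) j"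
    if j: "j \<in> {1..<length (is @ [i])}" for j
  proof (cases "j < length is")
    case True
    then have "(is @ [i]) ! j = is ! j" "(is @ [i]) ! (j - 1) = is ! (j - 1)"
      "span_first L (is @ [i]) j = span_first L is j"
      using j by (auto simp: nth_append span_first_def)
    then show ?thesis using g True j by (simp add: good_def)
  next
    case False
    then have len: "j = length is" "is \<noteq> []" using j by auto
    then have "(is @ [i]) ! j = i" "(is @ [i]) ! (j - 1) = last is"
      "span_first L (is @ [i]) j = vec.span (set (map L is))"
      by (auto simp: nth_append span_first_def last_conv_nth)
    then show ?thesis using chain len by simp
  qed
  ultimately show ?thesis using g i(1) by (simp add: good_def)
qed

text \<open>Append a form of \<open>X\<close> outside the span and, if its conjugate is still
  missing, a conjugate partner. The first addition respects the chain condition because the old span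
  is stable, the second because of proportionality.\<close>

lemma good_extend:
  assumes g: "good is" and inv: "cnj_invariant (vec.span (set (map L is)))"
    and X: "vec.subspace X" "cnj_invariant X" "X \<subseteq> vec.span {L i | i. i \<in> {1..d} \<and> L i \<in> X}"
    and sub: "vec.span (set (map L is)) \<subset> X"
  obtains js where "js \<noteq> []" "good (is @ js)" "cnj_invariant (vec.span (set (map L (is @ js))))"
    "vec.span (set (map L (is @ js))) \<subseteq> X"
proof -
  let ?S = "set (map L is)"
  have "\<exists>i\<in>{1..d}. L i \<in> X \<and> L i \<notin> vec.span ?S"
  proof (rule ccontr)
    assume "\<not> ?thesis"
    then have "{L i | i. i \<in> {1..d} \<and> L i \<in> X} \<subseteq> vec.span ?S" by blast
    then have "vec.span {L i | i. i \<in> {1..d} \<and> L i \<in> X} \<subseteq> vec.span ?S"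
      by (intro vec.span_minimal) auto
    then show False using X sub by blast
  qed
  then obtain i where i: "i \<in> {1..d}" "L i \<in> X" "L i \<notin> vec.span ?S" by blast
  have "L (last is) \<in> vec.span ?S" if "is \<noteq> []" using that by (intro vec.span_base) simp
  then have gi: "good (is @ [i])"
    using inv by (intro good_snoc g i) (auto simp: cnj_invariant_def)
  have subS: "?S \<subseteq> X" using sub vec.span_superset by blast
  show ?thesis
  proof (cases "cnj_vec (L i) \<in> vec.span (insert (L i) ?S)")
    case True
    show ?thesis
    proof (rule that[of "[i]"])
      show "cnj_invariant (vec.span (set (map L (is @ [i]))))"
        using cnj_invariant_span_insert[OF inv True] by simp
      show "vec.span (set (map L (is @ [i]))) \<subseteq> X"
        using subS i X(1) by (intro vec.span_minimal) auto
    qed (use gi in auto)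
  next
    case False
    obtain i' c where i': "i' \<in> {1..d}" "c \<noteq> 0" "L i' = c *s cnj_vec (L i)"
      by (rule exists_cnj_multiple[OF i(1)])
    have "L i' \<notin> vec.span (insert (L i) ?S)"
    proof
      assume "L i' \<in> vec.span (insert (L i) ?S)"
      then have "inverse c *s L i' \<in> vec.span (insert (L i) ?S)" by (rule vec.span_scale)
      then show False using i' False by simp
    qed
    then have gi': "good ((is @ [i]) @ [i'])"
      using i' by (intro good_snoc gi) auto
    have "L i' \<in> X" using i i' X by (simp add: cnj_invariant_def vec.subspace_scale)
    show ?thesis
    proof (rule that[of "[i, i']"])
      show "cnj_invariant (vec.span (set (map L (is @ [i, i']))))"
        using cnj_invariant_span_insert2[OF inv i'(2), of "L i"] i'(3)
        by (simp add: insert_commute)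
      show "vec.span (set (map L (is @ [i, i']))) \<subseteq> X"
        using subS i \<open>L i' \<in> X\<close> X(1) by (intro vec.span_minimal) auto
    qed (use gi' in auto)
  qed
qed

lemma good_extend_to:
  assumes "good is" "cnj_invariant (vec.span (set (map L is)))"
    and X: "vec.subspace X" "cnj_invariant X" "X \<subseteq> vec.span {L i | i. i \<in> {1..d} \<and> L i \<in> X}"
    and "vec.span (set (map L is)) \<subseteq> X"
  shows "\<exists>js. good (is @ js) \<and> vec.span (set (map L (is @ js))) = X"
  using assms(1,2,6)
proof (induction "vec.dim X - length is" arbitrary: "is" rule: less_induct)
  case (less "is")
  show ?case
  proof (cases "vec.span (set (map L is)) = X")
    case True
    then show ?thesis using less.prems by (intro exI[of _ "[]"]) simp
  next
    case False
    then have "vec.span (set (map L is)) \<subset> X" using less.prems by blast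
    then obtain js where js: "js \<noteq> []" "good (is @ js)" "cnj_invariant (vec.span (set (map L (is @ js))))"
      "vec.span (set (map L (is @ js))) \<subseteq> X"
      by (rule good_extend[OF less.prems(1,2) X])
    have "length (is @ js) \<le> vec.dim X"
      using vec.dim_subset[OF js(4)] dim_span_good[OF js(2)] by simp
    moreover have "length js > 0" using js(1) by simp
    ultimately have "vec.dim X - length (is @ js) < vec.dim X - length is"
      unfolding length_append by linarith
    from less.hyps[OF this js(2,3,4)] obtain ks where
      "good ((is @ js) @ ks)" "vec.span (set (map L ((is @ js) @ ks))) = X" by blast
    then show ?thesis by (intro exI[of _ "js @ ks"]) simp
  qed
qed

text \<open>The empty list is extended first until it spans \<open>X\<close> and then until it spans
  the whole space; the first part has length \<open>vec.dim X\<close> by independence.\<close>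

lemma exists_J_tuple:
  assumes span: "vec.span (L ` {1..d}) = UNIV"
    and X: "vec.subspace X" "cnj_invariant X" "X \<subseteq> vec.span {L i | i. i \<in> {1..d} \<and> L i \<in> X}"
  shows "\<exists>is\<in>J_tuples d L. span_first L is (vec.dim X) = X"
proof -
  obtain "is" where base: "good is" "vec.span (set (map L is)) = X"
    using good_extend_to[of "[]", OF good_Nil _ X] X vec.subspace_0
    by (auto simp: cnj_invariant_def)
  have "{L i | i. i \<in> {1..d} \<and> L i \<in> UNIV} = L ` {1..d}" by auto
  then obtain js where js: "good (is @ js)" "vec.span (set (map L (is @ js))) = UNIV"
    using good_extend_to[OF base(1), of UNIV] base X span
    by (auto simp: cnj_invariant_def vec.subspace_UNIV)
  have "length (is @ js) = CARD('n)"
    using dim_span_good[OF js(1)] unfolding js(2) vec_dim_card by simp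
  then have "is @ js \<in> J_tuples d L" using js by (simp add: J_tuples_iff)
  moreover have "length is = vec.dim X" using dim_span_good[OF base(1)] unfolding base(2) by simp
  then have "span_first L (is @ js) (vec.dim X) = X" using base by (simp add: span_first_def)
  ultimately show ?thesis by blast
qed

lemma span_eq_UNIV_of_J_tuple:
  assumes "is \<in> J_tuples d L"
  shows "vec.span (L ` {1..d}) = UNIV"
proof -
  have "set (map L is) \<subseteq> L ` {1..d}" "vec.dim (vec.span (set (map L is))) = CARD('n)"
    using assms dim_span_good by (auto simp: J_tuples_iff good_def)
  then have "CARD('n) \<le> vec.dim (vec.span (L ` {1..d}))"
    by (metis vec.dim_subset vec.span_mono)
  then show ?thesis
    using vec_dim_le_card[of "L ` {1..d}"] by (simp add: vec_span_eq_UNIV_iff)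
qed

section \<open>The slope condition and the invariant a(F)\<close>

text \<open>The volume criterion with real subspaces replaced by their complexifications; it links
  the volume to the spans occurring in a(F).\<close>

definition slope_condition :: bool where
  "slope_condition \<longleftrightarrow> (\<forall>X. vec.subspace X \<longrightarrow> cnj_invariant X \<longrightarrow> 0 < vec.dim X \<longrightarrow>
     vec.dim X < CARD('n) \<longrightarrow> num X * CARD('n) < d * vec.dim X)"

lemma a_invariant_less_iff:
  assumes n: "CARD('n) \<ge> 2"
  shows "(\<exists>a. a_invariant d L = Some a \<and> a < real d / real CARD('n)) \<longleftrightarrow>
    J_tuples d L \<noteq> {} \<and>
    (\<forall>is\<in>J_tuples d L. \<forall>j\<in>{1..<CARD('n)}. num (span_first L is j) * CARD('n) < d * j)"
proof (cases "J_tuples d L = {}")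
  case True
  then show ?thesis by (simp add: a_invariant_def)
next
  case False
  let ?Q = "{real (card {i \<in> {1..d}. L i \<in> span_first L is j}) / real j | is j.
                        is \<in> J_tuples d L \<and> j \<in> {1..<CARD('n)}}"
  have "J_tuples d L \<subseteq> {is. set is \<subseteq> {1..d} \<and> length is = CARD('n)}"
    by (auto simp: J_tuples_def I_tuples_def)
  then have "finite (J_tuples d L)"
    by (rule finite_subset) (simp add: finite_lists_length_eq)
  then have "finite ((\<lambda>(is, j). real (num (span_first L is j)) / real j) ` (J_tuples d L \<times> {1..<CARD('n)}))"
    by blast
  moreover have Q: "?Q = (\<lambda>(is, j). real (num (span_first L is j)) / real j) ` (J_tuples d L \<times> {1..<CARD('n)})"
    unfolding num_def by (auto; blast)
  ultimately have "finite ?Q" by simp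
  moreover have "?Q \<noteq> {}" unfolding Q using False n by auto
  ultimately have "Max ?Q < real d / real CARD('n) \<longleftrightarrow> (\<forall>x\<in>?Q. x < real d / real CARD('n))"
    by (rule Max_less_iff)
  also have "\<dots> \<longleftrightarrow> (\<forall>is\<in>J_tuples d L. \<forall>j\<in>{1..<CARD('n)}.
      real (num (span_first L is j)) / real j < real d / real CARD('n))"
    unfolding Q by auto
  also have "\<dots> \<longleftrightarrow> (\<forall>is\<in>J_tuples d L. \<forall>j\<in>{1..<CARD('n)}. num (span_first L is j) * CARD('n) < d * j)"
  proof (intro ball_cong refl)
    fix "is" and j :: nat assume "j \<in> {1..<CARD('n)}"
    then have "real (num (span_first L is j)) / real j < real d / real CARD('n) \<longleftrightarrow>
        real (num (span_first L is j) * CARD('n)) < real (d * j)"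
      by (simp add: field_simps)
    then show "real (num (span_first L is j)) / real j < real d / real CARD('n) \<longleftrightarrow>
        num (span_first L is j) * CARD('n) < d * j" by (simp only: of_nat_less_iff)
  qed
  finally show ?thesis using False by (simp add: a_invariant_def)
qed

text \<open>If the forms did not span, their span would be a proper stable subspace containing all
  \<open>d\<close> of them, against the condition. A tuple is then built by
  \<open>exists_J_tuple\<close> for the whole space.\<close>

lemma slope_condition_imp_J_nonempty:
  assumes slope_condition
  shows "vec.span (L ` {1..d}) = UNIV" and "J_tuples d L \<noteq> {}"
proof -
  have *: "{L i | i. i \<in> {1..d} \<and> L i \<in> UNIV} = L ` {1..d}" by auto
  let ?W = "vec.span (L ` {1..d})"
  show span: "?W = UNIV"
  proof (rule ccontr)
    assume "?W \<noteq> UNIV"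
    then have "vec.dim ?W < CARD('n)"
      using vec_dim_le_card[of "L ` {1..d}"] by (simp add: vec_span_eq_UNIV_iff)
    moreover have inv: "cnj_invariant ?W"
      using cnj_invariant_span_forms[of UNIV] unfolding * by (simp add: cnj_invariant_def)
    moreover have "L i \<in> ?W" if "i \<in> {1..d}" for i using that by (intro vec.span_base) auto
    then have "num ?W = d" by (metis (mono_tags, lifting) Collect_cong num_UNIV num_def UNIV_I)
    moreover have "0 < vec.dim ?W"
    proof -
      have "1 \<in> {1..d}" using d_pos by simp
      then have "L 1 \<in> ?W" "L 1 \<noteq> 0" using nonzero by (auto intro: vec.span_base)
      then show ?thesis by (metis gr0I singletonD subsetD vec.dim_eq_0)
    qed
    ultimately show False
      using assms unfolding slope_condition_def by (metis nat_mult_less_cancel_disj not_less_iff_gr_or_eq vec.subspace_span)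
  qed
  then show "J_tuples d L \<noteq> {}"
    using exists_J_tuple[of UNIV] unfolding * by (auto simp: cnj_invariant_def)
qed

text \<open>At an unstable stage the bounds for the two neighbours average to the bound for
  \<open>j\<close>. Equality would have to hold at both neighbours, which strictness permits only
  for the zero space and the whole space.\<close>

lemma num_span_first_less:
  assumes n: "CARD('n) \<ge> 2" and slope: slope_condition
    and exc: "CARD('n) = 2 \<Longrightarrow> \<not> (\<exists>v. cnj_vec v \<notin> vec.span {v} \<and>
      (\<forall>i\<in>{1..d}. L i \<in> vec.span {v} \<or> L i \<in> vec.span {cnj_vec v}))"
    and "is": "is \<in> J_tuples d L" and j: "j \<in> {1..<CARD('n)}"
  shows "num (span_first L is j) * CARD('n) < d * j"
proof -
  let ?S = "span_first L is" and ?n = "CARD('n)"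
  have g: "good is" "length is = ?n" using "is" by (auto simp: J_tuples_iff)
  have sub: "vec.subspace (?S k)" for k by (simp add: span_first_def)
  have strict: "num (?S k) * ?n < d * k" if "cnj_invariant (?S k)" "0 < k" "k < ?n" for k
    using slope[unfolded slope_condition_def, rule_format, of "?S k"] that sub[of k]
      dim_span_first[OF g(1), of k] g(2) by simp
  have nonstrict: "num (?S k) * ?n \<le> d * k" if k: "cnj_invariant (?S k)" "k \<le> ?n" for k
  proof -
    consider "k = 0" | "0 < k" "k < ?n" | "k = ?n" using k(2) by linarith
    then show ?thesis
    proof cases
      case 1
      then have "?S k = {0}" by (simp add: span_first_def)
      then show ?thesis by simp
    next
      case 2
      then show ?thesis using strict[of k] k by simp
    next
      case 3
      then show ?thesis using num_le_d by simp
    qed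
  qed
  show ?thesis
  proof (cases "cnj_invariant (?S j)")
    case True
    then show ?thesis using strict[of j] j by simp
  next
    case False
    then have inv: "cnj_invariant (?S (j - 1))" "cnj_invariant (?S (Suc j))"
      and notin: "cnj_vec (L (is ! (j - 1))) \<notin> ?S j"
      using span_first_cases[OF g(1), of j] g(2) j by auto
    have two: "2 * num (?S j) \<le> num (?S (j - 1)) + num (?S (Suc j))"
      and cap: "?S j \<inter> cnj_vec ` ?S j \<subseteq> ?S (j - 1)"
      using two_num_span_first[OF g(1) _ _ inv notin] g(2) j by auto
    have "2 * (num (?S j) * ?n) \<le> num (?S (j - 1)) * ?n + num (?S (Suc j)) * ?n"
      using mult_right_mono[OF two, of ?n] by (simp add: algebra_simps)
    moreover have "num (?S (j - 1)) * ?n \<le> d * (j - 1)" "num (?S (Suc j)) * ?n \<le> d * Suc j"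
      using nonstrict[OF inv(1)] nonstrict[OF inv(2)] j by auto
    moreover have "d * (j - 1) + d * Suc j = 2 * (d * j)"
      using j by (cases j) (auto simp: algebra_simps)
    ultimately have le: "num (?S j) * ?n \<le> d * j"
      and eqs: "num (?S j) * ?n = d * j \<Longrightarrow> num (?S (j - 1)) * ?n = d * (j - 1) \<and> num (?S (Suc j)) * ?n = d * Suc j"
      by linarith+
    have "num (?S j) * ?n \<noteq> d * j"
    proof
      assume eq: "num (?S j) * ?n = d * j"
      then have "num (?S (j - 1)) * ?n = d * (j - 1)" "num (?S (Suc j)) * ?n = d * Suc j" using eqs by auto
      moreover have "j - 1 < ?n" using j by auto
      ultimately have "\<not> 0 < j - 1" "\<not> Suc j < ?n"
        using strict[of "j - 1"] strict[of "Suc j"] inv by auto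
      then have j1: "j = 1" and n2: "?n = 2" using j by auto
      let ?v = "L (is ! 0)"
      have S1: "?S j = vec.span {?v}"
        using span_first_Suc[of 0 "is"] g(2) n2 j1 by simp
      have S0: "?S (j - 1) = {0}" by (simp add: j1 span_first_def)
      let ?A = "{i \<in> {1..d}. L i \<in> ?S j}" and ?B = "{i \<in> {1..d}. L i \<in> cnj_vec ` ?S j}"
      \<comment> \<open>Equality means that the line and its conjugate each contain half of the
        forms. Being disjoint, the two index sets exhaust all forms, which \<open>exc\<close>
        excludes.\<close>
      have "?A \<inter> ?B = {}" using cap nonzero S0 by blast
      then have "card (?A \<union> ?B) = num (?S j) + num (cnj_vec ` ?S j)"
        unfolding num_def by (intro card_Un_disjoint) auto
      also have "\<dots> = d" using num_cnj[OF sub] eq n2 j1 by simp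
      finally have "?A \<union> ?B = {1..d}" by (intro card_subset_eq) auto
      then have "L i \<in> vec.span {?v} \<or> L i \<in> vec.span {cnj_vec ?v}" if "i \<in> {1..d}" for i
      proof -
        have "u \<in> vec.span {cnj_vec ?v}" if "u \<in> cnj_vec ` vec.span {?v}" for u
          using that by (auto simp: vec.span_singleton)
        then show ?thesis using \<open>?A \<union> ?B = {1..d}\<close> that S1 by blast
      qed
      moreover have "cnj_vec ?v \<notin> vec.span {?v}" using notin S1 j1 by simp
      ultimately show False using exc[OF n2] by blast
    qed
    then show ?thesis using le by simp
  qed
qed

text \<open>Replace \<open>X\<close> by the span \<open>W\<close> of the forms it contains: the
  count is unchanged and the dimension does not grow. If \<open>W\<close> is nonzero it occurs as a
  stage of a tuple; if it is zero, no form lies in \<open>X\<close>.\<close>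

lemma slope_condition_of_tuples:
  assumes J: "J_tuples d L \<noteq> {}"
    and bound: "\<And>is j. is \<in> J_tuples d L \<Longrightarrow> j \<in> {1..<CARD('n)} \<Longrightarrow>
      num (span_first L is j) * CARD('n) < d * j"
  shows slope_condition
  unfolding slope_condition_def
proof (intro allI impI)
  fix X :: "(complex ^ 'n) set"
  assume X: "vec.subspace X" "cnj_invariant X" "0 < vec.dim X" "vec.dim X < CARD('n)"
  let ?G = "{L i | i. i \<in> {1..d} \<and> L i \<in> X}"
  define W where "W = vec.span ?G"
  have WX: "W \<subseteq> X" unfolding W_def using X(1) by (intro vec.span_minimal) auto
  have LW: "L i \<in> W" if "i \<in> {1..d}" "L i \<in> X" for i
    unfolding W_def using that by (intro vec.span_base) blast
  then have num: "num W = num X"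
    unfolding num_def using WX by (intro arg_cong[of _ _ card]) auto
  have G: "?G = {L i | i. i \<in> {1..d} \<and> L i \<in> W}" using WX LW by blast
  have "W = vec.span {L i | i. i \<in> {1..d} \<and> L i \<in> W}" unfolding G[symmetric] by (rule W_def)
  then have W: "vec.subspace W" "cnj_invariant W" "W \<subseteq> vec.span {L i | i. i \<in> {1..d} \<and> L i \<in> W}"
    using cnj_invariant_span_forms[OF X(2,1)] by (simp_all add: W_def)
  have dim: "vec.dim W \<le> vec.dim X" using WX by (rule vec.dim_subset)
  show "num X * CARD('n) < d * vec.dim X"
  proof (cases "vec.dim W = 0")
    case True
    then have "W \<subseteq> {0}" by simp
    then have "num W = 0" using num_mono[of W "{0}"] by simp
    then show ?thesis using num X(3) d_pos by simp
  next
    case False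
    obtain "is" where base: "is \<in> J_tuples d L" "span_first L is (vec.dim W) = W"
      using exists_J_tuple[OF _ W] span_eq_UNIV_of_J_tuple J by blast
    have "num W * CARD('n) < d * vec.dim W"
      using bound[OF base(1), of "vec.dim W"] base(2) False dim X(4) by simp
    also have "\<dots> \<le> d * vec.dim X" using dim by simp
    finally show ?thesis using num by simp
  qed
qed

lemma slope_condition_iff_real:
  "slope_condition \<longleftrightarrow> (\<forall>U. subspace U \<longrightarrow> 0 < dim U \<longrightarrow> dim U < CARD('n) \<longrightarrow>
     card {i \<in> {1..d}. Re_vec (L i) \<in> U \<and> Im_vec (L i) \<in> U} * CARD('n) < d * dim U)"
proof -
  have num: "num (complexification U) = card {i \<in> {1..d}. Re_vec (L i) \<in> U \<and> Im_vec (L i) \<in> U}" for U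
    by (simp add: num_def complexification_def)
  show ?thesis
  proof
    assume slope_condition
    then show "\<forall>U. subspace U \<longrightarrow> 0 < dim U \<longrightarrow> dim U < CARD('n) \<longrightarrow>
       card {i \<in> {1..d}. Re_vec (L i) \<in> U \<and> Im_vec (L i) \<in> U} * CARD('n) < d * dim U"
      unfolding slope_condition_def num[symmetric]
      by (metis subspace_complexification cnj_invariant_complexification dim_complexification)
  next
    assume *: "\<forall>U. subspace U \<longrightarrow> 0 < dim U \<longrightarrow> dim U < CARD('n) \<longrightarrow>
       card {i \<in> {1..d}. Re_vec (L i) \<in> U \<and> Im_vec (L i) \<in> U} * CARD('n) < d * dim U"
    show slope_condition
      unfolding slope_condition_def
    proof (intro allI impI)
      fix X :: "(complex ^ 'n) set"
      assume X: "vec.subspace X" "cnj_invariant X" "0 < vec.dim X" "vec.dim X < CARD('n)"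
      obtain U where U: "subspace U" "X = complexification U"
        by (rule cnj_invariant_imp_complexification[OF X(1,2)])
      then show "num X * CARD('n) < d * vec.dim X"
        using * X(3,4) dim_complexification[OF U(1)] num[of U] by simp
    qed
  qed
qed

end

section \<open>Powers of definite binary quadratic forms\<close>

lemma mconst_mult: "mconst (a * b) = mconst a * (mconst b :: ('n, 'a::comm_semiring_1) mpoly)"
  by (simp add: mconst_def mult_single)

lemma mconst_one [simp]: "mconst 1 = 1"
  by (simp add: mconst_def)

lemma mconst_prod: "mconst (\<Prod>k\<in>A. f k) = (\<Prod>k\<in>A. mconst (f k) :: ('n, 'a::comm_semiring_1) mpoly)"
  by (induction A rule: infinite_finite_induct) (auto simp: mconst_mult)

lemma lookup_mconst_mult:
  "Poly_Mapping.lookup (mconst c * p) m = c * Poly_Mapping.lookup (p :: ('n, 'a::comm_semiring_1) mpoly) m"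
  unfolding mconst_def mult_map_scale_conv_mult[symmetric] by (simp add: lookup_map)

lemma lookup_linear_form:
  "Poly_Mapping.lookup (linear_form v) m = (\<Sum>i\<in>UNIV. v $ i when Poly_Mapping.single i 1 = m)"
  by (simp add: linear_form_def lookup_sum lookup_single)

lemma linear_form_scale: "linear_form (c *s v) = mconst c * linear_form v"
  by (rule poly_mapping_eqI)
     (simp add: lookup_mconst_mult lookup_linear_form sum_distrib_left mult_when)

lemma linear_form_add: "linear_form (u + v) = linear_form u + linear_form v"
  by (rule poly_mapping_eqI)
     (simp add: lookup_add lookup_linear_form when_add_distrib sum.distrib)

lemma map_linear_form:
  "Poly_Mapping.map complex_of_real (linear_form v) = linear_form (complex_vec v)"
  by (rule poly_mapping_eqI)
     (auto simp: lookup_map lookup_linear_form complex_vec_def when_def intro!: sum.cong)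

lemma homogeneous_mult:
  assumes "homogeneous j p" "homogeneous k (q :: ('n::finite, 'a::comm_semiring_1) mpoly)"
  shows "homogeneous (j + k) (p * q)"
  unfolding homogeneous_def
proof
  fix m assume "m \<in> Poly_Mapping.keys (p * q)"
  then obtain a b where "m = a + b" "a \<in> Poly_Mapping.keys p" "b \<in> Poly_Mapping.keys q"
    using Poly_Mapping.keys_mult[of p q] by blast
  then show "(\<Sum>i\<in>UNIV. Poly_Mapping.lookup m i) = j + k"
    using assms by (simp add: homogeneous_def lookup_add sum.distrib)
qed

lemma homogeneous_add:
  assumes "homogeneous k p" "homogeneous k (q :: ('n::finite, 'a::comm_semiring_1) mpoly)"
  shows "homogeneous k (p + q)"
  using assms Poly_Mapping.keys_add[of p q] unfolding homogeneous_def by blast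

lemma homogeneous_linear_form: "homogeneous 1 (linear_form v)"
  unfolding homogeneous_def
proof
  fix m assume "m \<in> Poly_Mapping.keys (linear_form v)"
  then obtain i where "m = Poly_Mapping.single i 1"
    by (auto simp: in_keys_iff lookup_linear_form when_def split: if_splits elim!: sum.not_neutral_contains_not_neutral)
  then show "(\<Sum>i\<in>UNIV. Poly_Mapping.lookup m i) = 1"
    by (simp add: lookup_single when_def)
qed

lemma cnj_symmetric_forms_of_factorization:
  assumes "linear_factorization F d L" "d \<ge> 1"
  shows "cnj_symmetric_forms d L"
  using assms linear_factorization_eval_cnj[OF assms(1)]
  by unfold_locales (auto simp: linear_factorization_def)

text \<open>
  If \<open>v\<close> and its conjugate are not proportional, then \<open>v\<close> times its conjugate is the positive
  definite form \<open>(Re v)\<^sup>2 + (Im v)\<^sup>2\<close>; the multiplicities of the two factors agree because \<open>F\<close> is real.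
\<close>
lemma power_of_definite_quadratic_form:
  fixes F :: "('n::finite, int) mpoly"
  assumes F: "linear_factorization F d L" and d: "d \<ge> 1" and n: "CARD('n) = 2"
    and v: "cnj_vec v \<notin> vec.span {v}"
    and L: "\<And>i. i \<in> {1..d} \<Longrightarrow> L i \<in> vec.span {v} \<or> L i \<in> vec.span {cnj_vec v}"
  obtains c :: real and Q :: "('n, real) mpoly" and k where
    "c \<noteq> 0" "positive_definite_quadratic_form Q" "Poly_Mapping.map real_of_int F = mconst c * Q ^ k"
proof -
  interpret cnj_symmetric_forms d L by (rule cnj_symmetric_forms_of_factorization[OF F d])
  define A where "A = {i \<in> {1..d}. L i \<in> vec.span {v}}"
  define B where "B = {i \<in> {1..d}. L i \<in> vec.span {cnj_vec v}}"
  define k where "k = card A"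
  have "cnj_vec ` vec.span {v} = vec.span {cnj_vec v}"
  proof (intro equalityI subsetI)
    fix u assume "u \<in> cnj_vec ` vec.span {v}"
    then show "u \<in> vec.span {cnj_vec v}" by (auto simp: vec.span_singleton)
  next
    fix u assume "u \<in> vec.span {cnj_vec v}"
    then obtain c where "u = c *s cnj_vec v" by (auto simp: vec.span_singleton)
    then have "cnj_vec u = cnj c *s v" by simp
    then show "u \<in> cnj_vec ` vec.span {v}" by (auto simp: cnj_vec_image_iff vec.span_singleton)
  qed
  then have "card B = k"
    using num_cnj[of "vec.span {v}"] by (simp add: num_def A_def B_def k_def)
  have "A \<inter> B = {}"
  proof (rule ccontr)
    assume "A \<inter> B \<noteq> {}"
    then obtain i where i: "i \<in> {1..d}" "L i \<in> vec.span {v}" "L i \<in> vec.span {cnj_vec v}"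
      by (auto simp: A_def B_def)
    then obtain a where a: "L i = a *s cnj_vec v" by (auto simp: vec.span_singleton)
    have "a \<noteq> 0" using a nonzero[OF i(1)] by auto
    have "inverse a *s L i \<in> vec.span {v}" using i(2) by (rule vec.span_scale)
    then show False using v a \<open>a \<noteq> 0\<close> by simp
  qed
  have AB: "{1..d} = A \<union> B" using L unfolding A_def B_def by blast
  have fin: "finite A" "finite B" by (auto simp: A_def B_def)
  have "\<forall>i\<in>A. \<exists>c. L i = c *s v" by (auto simp: A_def vec.span_singleton)
  then obtain \<alpha> where \<alpha>: "\<And>i. i \<in> A \<Longrightarrow> L i = \<alpha> i *s v" by metis
  have "\<forall>i\<in>B. \<exists>c. L i = c *s cnj_vec v" by (auto simp: B_def vec.span_singleton)
  then obtain \<beta> where \<beta>: "\<And>i. i \<in> B \<Longrightarrow> L i = \<beta> i *s cnj_vec v" by metis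
  define C where "C = (\<Prod>i\<in>A. \<alpha> i) * (\<Prod>i\<in>B. \<beta> i)"
  define P where "P = linear_form (Re_vec v)"
  define R where "R = linear_form (Im_vec v)"
  define Q where "Q = P * P + R * R"
  let ?m = "Poly_Mapping.map complex_of_real"
  have map_mult: "?m (p * q) = ?m p * ?m q" for p q :: "('n, real) mpoly"
    by (rule map_hom_mult) auto
  have map_add: "?m (p + q) = ?m p + ?m q" for p q :: "('n, real) mpoly"
    by (rule poly_mapping_eqI) (simp add: lookup_map lookup_add)
  have map_power: "?m (p ^ j) = ?m p ^ j" for p :: "('n, real) mpoly" and j
  proof (induction j)
    case 0
    show ?case by (rule poly_mapping_eqI) (simp add: lookup_map lookup_one when_def)
  qed (simp add: map_mult)
  have lv: "linear_form v = ?m P + mconst \<i> * ?m R"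
    using complex_vec_Re_Im[of v] by (metis P_def R_def linear_form_add linear_form_scale map_linear_form)
  have "cnj_vec v = complex_vec (Re_vec v) + (- \<i>) *s complex_vec (Im_vec v)"
    by (simp add: complex_vec_def Re_vec_def Im_vec_def cnj_vec_def vec_eq_iff complex_eq_iff)
  then have lcv: "linear_form (cnj_vec v) = ?m P + mconst (- \<i>) * ?m R"
    by (metis P_def R_def linear_form_add linear_form_scale map_linear_form)
  have "mconst (- \<i>) * mconst \<i> = (1 :: ('n, complex) mpoly)"
    by (simp add: mconst_def mult_single)
  moreover have "mconst (- \<i>) + mconst \<i> = (0 :: ('n, complex) mpoly)"
    by (simp add: mconst_def flip: single_add)
  ultimately have quad: "linear_form v * linear_form (cnj_vec v) = ?m Q"
  proof -
    have "linear_form v * linear_form (cnj_vec v) = ?m P * ?m P +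
        (mconst (- \<i>) + mconst \<i>) * (?m P * ?m R) + (mconst (- \<i>) * mconst \<i>) * (?m R * ?m R)"
      unfolding lv lcv by (simp only: distrib_left distrib_right mult_ac add_ac)
    then show ?thesis
      using \<open>mconst (- \<i>) * mconst \<i> = 1\<close> \<open>mconst (- \<i>) + mconst \<i> = 0\<close>
      by (simp add: Q_def map_mult map_add)
  qed
  have "Poly_Mapping.map of_int F = (\<Prod>i\<in>A. linear_form (L i)) * (\<Prod>i\<in>B. linear_form (L i))"
    using F prod.union_disjoint[OF fin \<open>A \<inter> B = {}\<close>]
    unfolding linear_factorization_def AB by metis
  also have "(\<Prod>i\<in>A. linear_form (L i)) = mconst (\<Prod>i\<in>A. \<alpha> i) * linear_form v ^ k"
    using \<alpha> by (simp add: linear_form_scale prod.distrib mconst_prod k_def)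
  also have "(\<Prod>i\<in>B. linear_form (L i)) = mconst (\<Prod>i\<in>B. \<beta> i) * linear_form (cnj_vec v) ^ k"
    using \<beta> \<open>card B = k\<close> by (simp add: linear_form_scale prod.distrib mconst_prod)
  finally have "Poly_Mapping.map of_int F = mconst C * (linear_form v * linear_form (cnj_vec v)) ^ k"
    by (simp add: C_def mconst_mult power_mult_distrib mult_ac)
  then have "Poly_Mapping.map of_int F = mconst C * ?m (Q ^ k)"
    by (simp add: quad map_power)
  then have coeff: "of_int (Poly_Mapping.lookup F m) = C * of_real (Poly_Mapping.lookup (Q ^ k) m)" for m
    by (metis (no_types, lifting) lookup_map lookup_mconst_mult of_int_0 of_real_0)
  obtain w where w: "\<forall>i\<in>{1..d}. form_eval (L i) w \<noteq> 0"
    using exists_common_nonzero by blast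
  have "F \<noteq> 0"
  proof
    assume "F = 0"
    then have "Poly_Mapping.map complex_of_int F = 0" by (simp add: map_eq_zero_iff)
    then show False using linear_factorization_eval[OF F, of w] w by simp
  qed
  then obtain m where m: "Poly_Mapping.lookup F m \<noteq> 0" by (metis lookup_zero poly_mapping_eqI)
  then have "C \<noteq> 0" using coeff[of m] by auto
  have "Poly_Mapping.lookup (Q ^ k) m \<noteq> 0" using coeff[of m] m by auto
  \<comment> \<open>Comparing one nonzero coefficient of \<open>F\<close> exhibits \<open>C\<close>
    as a quotient of real numbers.\<close>
  then have "C = of_real (of_int (Poly_Mapping.lookup F m) / Poly_Mapping.lookup (Q ^ k) m)"
    using coeff[of m] by (simp add: field_simps)
  then obtain c where c: "C = of_real c" by blast
  show ?thesis
  proof (rule that[of c Q k])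
    show "c \<noteq> 0" using c \<open>C \<noteq> 0\<close> by simp
    show "Poly_Mapping.map real_of_int F = mconst c * Q ^ k"
    proof (rule poly_mapping_eqI)
      fix m
      have "complex_of_real (of_int (Poly_Mapping.lookup F m)) = of_real (c * Poly_Mapping.lookup (Q ^ k) m)"
        using coeff[of m] c by simp
      then have "of_int (Poly_Mapping.lookup F m) = c * Poly_Mapping.lookup (Q ^ k) m"
        by (simp only: of_real_eq_iff)
      then show "Poly_Mapping.lookup (Poly_Mapping.map real_of_int F) m = Poly_Mapping.lookup (mconst c * Q ^ k) m"
        by (simp add: lookup_map lookup_mconst_mult)
    qed
    show "positive_definite_quadratic_form Q"
      unfolding positive_definite_quadratic_form_def
    proof (intro conjI allI impI)
      have "homogeneous (1 + 1) Q"
        unfolding Q_def P_def R_def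
        by (intro homogeneous_add homogeneous_mult homogeneous_linear_form)
      then show "homogeneous 2 Q" by (simp only: one_add_one)
      fix x :: "real ^ 'n" assume x: "x \<noteq> 0"
      have eval: "mpoly_eval Q x = (Re_vec v \<bullet> x)\<^sup>2 + (Im_vec v \<bullet> x)\<^sup>2"
        by (simp add: Q_def P_def R_def mpoly_eval_add mpoly_eval_mult mpoly_eval_linear_form
            inner_vec_def power2_eq_square)
      \<comment> \<open>At a common real zero \<open>x\<close>, both \<open>v\<close> and its
        conjugate would vanish. They span the complex plane, so the form with coefficient vector
        \<open>x\<close> would vanish there too, making the squared length of \<open>x\<close>
        zero.\<close>
      have "\<not> (Re_vec v \<bullet> x = 0 \<and> Im_vec v \<bullet> x = 0)"
      proof
        assume 0: "Re_vec v \<bullet> x = 0 \<and> Im_vec v \<bullet> x = 0"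
        have "form_eval v (complex_vec x) = 0" "form_eval (cnj_vec v) (complex_vec x) = 0"
          using 0 by (simp_all add: complex_eq_iff Re_form_eval Im_form_eval)
        then have "{v, cnj_vec v} \<subseteq> {u. form_eval u (complex_vec x) = 0}" by simp
        moreover have "vec.subspace {u. form_eval u (complex_vec x) = 0}"
          by (simp add: vec.subspace_def form_eval_add_left form_eval_scale_left)
             (simp add: form_eval_def)
        ultimately have sub: "vec.span {v, cnj_vec v} \<subseteq> {u. form_eval u (complex_vec x) = 0}"
          by (rule vec.span_minimal)
        have "v \<noteq> 0" using v vec.span_zero by force
        then have "vec.independent {v}" using vec.independent_empty by simp
        then have "vec.independent {cnj_vec v, v}" using vec.independent_insertI[OF v] by blast
        moreover have "cnj_vec v \<noteq> v" using v vec.span_base by force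
        then have "card {cnj_vec v, v} = 2" by simp
        ultimately have "vec.dim {v, cnj_vec v} = 2"
          by (metis insert_commute vec.dim_eq_card_independent)
        then have "vec.span {v, cnj_vec v} = UNIV" using n by (simp add: vec_span_eq_UNIV_iff)
        then have "form_eval (complex_vec x) (complex_vec x) = 0" using sub by auto
        then have "Re (form_eval (complex_vec x) (complex_vec x)) = 0" by simp
        then show False using x by (simp add: Re_form_eval)
      qed
      then have "(Re_vec v \<bullet> x)\<^sup>2 + (Im_vec v \<bullet> x)\<^sup>2 > 0" by (simp add: sum_power2_gt_zero_iff)
      then show "mpoly_eval Q x > 0" by (simp add: eval)
    qed
  qed
qed

section \<open>The finiteness criterion\<close>

text \<open>The absolute value of a complex number lies between the maximum and the sum of the
  absolute values of its real and imaginary parts; the two volume lemmas need one of these bounds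
  each.\<close>

lemma form_volume_finite_iff:
  fixes F :: "('n::finite, int) mpoly"
  assumes F: "linear_factorization F d L" and d: "d \<ge> 1" and n: "CARD('n) \<ge> 2"
  shows "form_volume F < \<infinity> \<longleftrightarrow>
    (\<forall>U. subspace U \<longrightarrow> 0 < dim U \<longrightarrow> dim U < CARD('n) \<longrightarrow>
     card {i \<in> {1..d}. Re_vec (L i) \<in> U \<and> Im_vec (L i) \<in> U} * CARD('n) < d * dim U)"
    (is "_ \<longleftrightarrow> ?slope")
proof -
  define g where "g i x = norm (form_eval (L i) (complex_vec x))" for i and x :: "real ^ 'n"
  define S where "S = {x. (\<Prod>i=1..d. g i x) \<le> 1}"
  have vol: "form_volume F = emeasure lborel S"
    unfolding form_volume_def S_def g_def linear_factorization_eval_real[OF F] ..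
  have g: "g i x = sqrt ((Re_vec (L i) \<bullet> x)\<^sup>2 + (Im_vec (L i) \<bullet> x)\<^sup>2)" for i x
    by (simp add: g_def cmod_def Re_form_eval Im_form_eval)
  have "closed S"
    unfolding S_def g by (intro closed_Collect_le continuous_intros)
  then have S: "S \<in> sets borel" by simp
  have ge: "max \<bar>Re_vec (L i) \<bullet> x\<bar> \<bar>Im_vec (L i) \<bullet> x\<bar> \<le> g i x" for i x
    using real_sqrt_sum_squares_ge1 real_sqrt_sum_squares_ge2 abs_Re_le_cmod abs_Im_le_cmod
    unfolding g_def by (metis Im_form_eval Re_form_eval max.bounded_iff)
  have le: "g i x \<le> \<bar>Re_vec (L i) \<bullet> x\<bar> + \<bar>Im_vec (L i) \<bullet> x\<bar>" for i x
    using cmod_le[of "form_eval (L i) (complex_vec x)"] by (simp add: g_def Re_form_eval Im_form_eval)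
  show ?thesis
  proof
    assume slope: ?slope
    have nz: "Re_vec (L i) \<noteq> 0 \<or> Im_vec (L i) \<noteq> 0" if "i \<in> {1..d}" for i
      using F that vec_eq_iff_Re_Im[of "L i" 0] by (auto simp: linear_factorization_def)
    obtain T where T: "T \<in> lmeasurable" "S \<subseteq> T"
      using finite_volume_of_subspace_bound[OF n, of "{1..d}" "\<lambda>i. Re_vec (L i)" "\<lambda>i. Im_vec (L i)" g]
        nz ge slope d unfolding S_def by auto
    \<comment> \<open>The covering set \<open>T\<close> is only Lebesgue measurable, so the
      comparison is made in the completed measure, which agrees with \<open>lborel\<close> on the
      Borel set \<open>S\<close>.\<close>
    have "emeasure lborel S = emeasure lebesgue S" using S by simp
    also have "\<dots> \<le> emeasure lebesgue T" using T by (intro emeasure_mono) (auto simp: fmeasurable_def)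
    also have "\<dots> < \<infinity>" using T(1) unfolding fmeasurable_def by blast
    finally show "form_volume F < \<infinity>" by (simp add: vol)
  next
    assume fin: "form_volume F < \<infinity>"
    show ?slope
    proof (intro allI impI, rule ccontr)
      fix U :: "(real ^ 'n) set"
      assume U: "subspace U" "0 < dim U" "dim U < CARD('n)"
        and "\<not> card {i \<in> {1..d}. Re_vec (L i) \<in> U \<and> Im_vec (L i) \<in> U} * CARD('n) < d * dim U"
      then have "emeasure lborel S = \<infinity>"
        unfolding S_def using le S d
        by (intro infinite_volume_of_subspace[of "{1..d}" U "\<lambda>i. Re_vec (L i)" "\<lambda>i. Im_vec (L i)"])
           (auto simp: g_def S_def)
      then show False using fin vol by simp
    qed
  qed
qed

theorem mainTheorem4:
  fixes F :: "('n::finite, int) mpoly" and d :: nat and L :: "nat \<Rightarrow> complex ^ 'n"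
  assumes "CARD('n) \<ge> 2" and "d \<ge> 1"
    and "linear_factorization F d L"
    and "CARD('n) = 2 \<longrightarrow>
      \<not> (\<exists>(c::real) (Q :: ('n, real) mpoly) (k::nat).
            c \<noteq> 0 \<and> positive_definite_quadratic_form Q \<and>
            Poly_Mapping.map real_of_int F = mconst c * Q ^ k)"
  shows "form_volume F < \<infinity> \<longleftrightarrow>
    (\<exists>a. a_invariant d L = Some a \<and> a < real d / real CARD('n))"
proof -
  interpret cnj_symmetric_forms d L
    by (rule cnj_symmetric_forms_of_factorization[OF assms(3,2)])
  have exc: "\<not> (\<exists>v. cnj_vec v \<notin> vec.span {v} \<and>
      (\<forall>i\<in>{1..d}. L i \<in> vec.span {v} \<or> L i \<in> vec.span {cnj_vec v}))" if n: "CARD('n) = 2"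
  proof
    assume "\<exists>v. cnj_vec v \<notin> vec.span {v} \<and>
      (\<forall>i\<in>{1..d}. L i \<in> vec.span {v} \<or> L i \<in> vec.span {cnj_vec v})"
    then obtain v where v: "cnj_vec v \<notin> vec.span {v}"
      "\<And>i. i \<in> {1..d} \<Longrightarrow> L i \<in> vec.span {v} \<or> L i \<in> vec.span {cnj_vec v}" by blast
    then show False
      using power_of_definite_quadratic_form[OF assms(3,2) n v] assms(4) n by blast
  qed
  have "form_volume F < \<infinity> \<longleftrightarrow> slope_condition"
    unfolding slope_condition_iff_real by (rule form_volume_finite_iff[OF assms(3,2,1)])
  also have "\<dots> \<longleftrightarrow> J_tuples d L \<noteq> {} \<and>
      (\<forall>is\<in>J_tuples d L. \<forall>j\<in>{1..<CARD('n)}. num (span_first L is j) * CARD('n) < d * j)"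
    using num_span_first_less[OF assms(1) _ exc] slope_condition_imp_J_nonempty(2)
      slope_condition_of_tuples by blast
  finally show ?thesis by (simp only: a_invariant_less_iff[OF assms(1)])
qed

end
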